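(* Let $n\ge 1$, let $1<\mathfrak{p}<+\infty$ be a constant exponent, let $p\in\mathcal{P}^{\log}(\mathbb{R}^n)$ be a variable exponent with $1<p^-\leq p^+<+\infty$, and let $0<s<\min\{n/p^+,n/\mathfrak{p}\}$. Set $\theta=\frac{s\mathfrak{p}}{n}$ and let the function $\sigma(\cdot)$ be given by $$\sigma(\cdot)=\frac{p(\cdot)}{1-\theta}=\frac{n\,p(\cdot)}{n-s\mathfrak{p}}.$$ Then there is a constant $C>0$ (independent of $f$) such that for every $f\in\mathcal{L}^{p(\cdot)}_{\mathfrak{p}}(\mathbb{R}^n)$, $$\|I_s(f)\|_{L^{\sigma(\cdot)}(\mathbb{R}^n)}\leq C\,\|f\|_{\mathcal{L}^{p(\cdot)}_{\mathfrak{p}}(\mathbb{R}^n)}.$$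
   Context: Variable exponents: $\mathcal{P}(\mathbb{R}^n)$ is the set of measurable functions $p:\mathbb{R}^n\to[1,+\infty]$; $p^-=\operatorname{ess\,inf}_{x}p(x)$ and $p^+=\operatorname{ess\,sup}_{x}p(x)$. The class $\mathcal{P}^{\log}(\mathbb{R}^n)$ consists of those $p\in\mathcal{P}(\mathbb{R}^n)$ for which there is a constant $C$ with $$\left|\frac{1}{p(x)}-\frac{1}{p(y)}\right|\leq\frac{C}{\log(e+1/|x-y|)}\ \text{ for all }x,y\in\mathbb{R}^n,\qquad \left|\frac{1}{p(x)}-\frac{1}{p_\infty}\right|\leq\frac{C}{\log(e+|x|)}\ \text{ for all }x\in\mathbb{R}^n,$$ where $\frac{1}{p_\infty}=\lim_{|x|\to+\infty}\frac{1}{p(x)}$. Variable Lebesgue space: for $p\in\mathcal{P}(\mathbb{R}^n)$ with $1<p^-\le p^+<+\infty$, $L^{p(\cdot)}(\mathbb{R}^n)$ is the set of measurable functions $f$ for which the Luxemburg norm $\|f\|_{L^{p(\cdot)}(\mathbb{R}^n)}=\inf\{\lambda>0:\int_{\mathbb{R}^n}|f(x)/\lambda|^{p(x)}dx\leq1\}$ is finite. Mixed Lebesgue space: $\mathcal{L}^{p(\cdot)}_{\mathfrak{p}}(\mathbb{R}^n)=L^{p(\cdot)}(\mathbb{R}^n)\cap L^{\mathfrak{p}}(\mathbb{R}^n)$, with norm $\|f\|_{\mathcal{L}^{p(\cdot)}_{\mathfrak{p}}(\mathbb{R}^n)}=\max\{\|f\|_{L^{p(\cdot)}(\mathbb{R}^n)},\|f\|_{L^{\mathfrak{p}}(\mathbb{R}^n)}\}$.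 Riesz potential: for $0<s<n$, $I_s$ is defined at the Fourier level by $\widehat{I_s(f)}(\xi)=|\xi|^{-s}\widehat{f}(\xi)$, equivalently $I_s(f)(x)=C(n,s)\int_{\mathbb{R}^n}\frac{f(y)}{|x-y|^{n-s}}\,dy$ with a suitable normalizing constant $C(n,s)>0$. *)

theory Defs
  imports "HOL-Analysis.Analysis" "HOL-Probability.Essential_Supremum"
begin

definition variable_exponents :: "(real ^ 'n \<Rightarrow> ereal) set"
  where "variable_exponents = {p \<in> borel_measurable lebesgue. \<forall>x. 1 \<le> p x}"

text \<open>
  The library has only the essential supremum, as the limes superior along the almost-everywhere
  filter. The essential infimum is the dual notion.
\<close>

definition essinf :: "'a measure \<Rightarrow> ('a \<Rightarrow> ereal) \<Rightarrow> ereal"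
  where "essinf M f = Liminf (ae_filter M) f"

definition exponent_lower :: "(real ^ 'n \<Rightarrow> ereal) \<Rightarrow> ereal"
  where "exponent_lower p = essinf lebesgue p"

definition exponent_upper :: "(real ^ 'n \<Rightarrow> ereal) \<Rightarrow> ereal"
  where "exponent_upper p = esssup lebesgue p"

text \<open>At a point with \<open>p x = \<infinity>\<close> the reciprocal is \<open>0\<close>.\<close>

definition recip :: "(real ^ 'n \<Rightarrow> ereal) \<Rightarrow> real ^ 'n \<Rightarrow> real"
  where "recip p x = real_of_ereal (1 / p x)"

text \<open>
  In the first condition the left-hand side vanishes for \<open>x = y\<close>, so the convention \<open>1 / 0 = 0\<close>
  is harmless there. The number \<open>L\<close> is \<open>1 / p\<^sub>\<infinity>\<close>.
\<close>

definition log_Hoelder_exponents :: "(real ^ 'n \<Rightarrow> ereal) set"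
  where "log_Hoelder_exponents = {p \<in> variable_exponents.
    \<exists>C L. (\<forall>x y. \<bar>recip p x - recip p y\<bar> \<le> C / ln (exp 1 + 1 / norm (x - y))) \<and>
          (recip p \<longlongrightarrow> L) at_infinity \<and>
          (\<forall>x. \<bar>recip p x - L\<bar> \<le> C / ln (exp 1 + norm x))}"

text \<open>
  The scalar field \<open>'b::{real_normed_field, euclidean_space}\<close> stands for the reals or the complex
  numbers. The modular is meant for exponents that are finite almost everywhere
  (\<open>p\<^sup>+ < \<infinity>\<close>); the value of the integrand where \<open>p x = \<infinity>\<close> is then irrelevant.
\<close>

definition modular ::
    "(real ^ 'n \<Rightarrow> ereal) \<Rightarrow> (real ^ 'n \<Rightarrow> 'b::{real_normed_field, euclidean_space}) \<Rightarrow> ennreal"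
  where "modular p f = (\<integral>\<^sup>+x. ennreal (norm (f x) powr real_of_ereal (p x)) \<partial>lebesgue)"

text \<open>The norms take the value \<open>\<infinity>\<close> outside the space; in particular \<open>Inf {} = \<infinity>\<close> below.\<close>

definition luxemburg_norm ::
    "(real ^ 'n \<Rightarrow> ereal) \<Rightarrow> (real ^ 'n \<Rightarrow> 'b::{real_normed_field, euclidean_space}) \<Rightarrow> ennreal"
  where "luxemburg_norm p f = Inf {ennreal l | l. 0 < l \<and> modular p (\<lambda>x. f x /\<^sub>R l) \<le> 1}"

definition variable_Lebesgue ::
    "(real ^ 'n \<Rightarrow> ereal) \<Rightarrow> (real ^ 'n \<Rightarrow> 'b::{real_normed_field, euclidean_space}) set"
  where "variable_Lebesgue p = {f \<in> borel_measurable lebesgue. luxemburg_norm p f < \<infinity>}"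

definition Lebesgue_norm ::
    "real \<Rightarrow> (real ^ 'n \<Rightarrow> 'b::{real_normed_field, euclidean_space}) \<Rightarrow> ennreal"
  where "Lebesgue_norm q f =
    (let I = (\<integral>\<^sup>+x. ennreal (norm (f x) powr q) \<partial>lebesgue)
     in if I = \<infinity> then \<infinity> else ennreal (enn2real I powr (1 / q)))"

definition Lebesgue_space ::
    "real \<Rightarrow> (real ^ 'n \<Rightarrow> 'b::{real_normed_field, euclidean_space}) set"
  where "Lebesgue_space q = {f \<in> borel_measurable lebesgue. Lebesgue_norm q f < \<infinity>}"

definition mixed_Lebesgue ::
    "(real ^ 'n \<Rightarrow> ereal) \<Rightarrow> real \<Rightarrow> (real ^ 'n \<Rightarrow> 'b::{real_normed_field, euclidean_space}) set"
  where "mixed_Lebesgue p q = variable_Lebesgue p \<inter> Lebesgue_space q"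

definition mixed_norm ::
    "(real ^ 'n \<Rightarrow> ereal) \<Rightarrow> real \<Rightarrow> (real ^ 'n \<Rightarrow> 'b::{real_normed_field, euclidean_space}) \<Rightarrow> ennreal"
  where "mixed_norm p q f = max (luxemburg_norm p f) (Lebesgue_norm q f)"

text \<open>
  The constant for which convolution with \<open>riesz_constant n s * norm x powr (s - n)\<close> is the Fourier
  multiplier \<open>norm \<xi> powr (- s)\<close>, when the Fourier transform of \<open>f\<close> at \<open>\<xi>\<close> is the integral of
  \<open>f x * exp (- \<i> * (x \<bullet> \<xi>))\<close>. Thus \<open>riesz_potential s\<close> is the power \<open>- s / 2\<close> of the
  nonnegative Laplacian.
\<close>

definition riesz_constant :: "nat \<Rightarrow> real \<Rightarrow> real"
  where "riesz_constant n s =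
    Gamma ((real n - s) / 2) / (pi powr (real n / 2) * 2 powr s * Gamma (s / 2))"

text \<open>The value \<open>0\<close> of the integrand at the singularity \<open>y = x\<close> is irrelevant.\<close>

definition riesz_integrand ::
    "real \<Rightarrow> (real ^ 'n \<Rightarrow> 'b::{real_normed_field, euclidean_space}) \<Rightarrow> real ^ 'n \<Rightarrow> real ^ 'n \<Rightarrow> 'b"
  where "riesz_integrand s f x y = f y /\<^sub>R (norm (x - y) powr (real CARD('n) - s))"

definition riesz_potential ::
    "real \<Rightarrow> (real ^ 'n \<Rightarrow> 'b::{real_normed_field, euclidean_space}) \<Rightarrow> real ^ 'n \<Rightarrow> 'b"
  where "riesz_potential s f x =
    riesz_constant CARD('n) s *\<^sub>R (\<integral>y. riesz_integrand s f x y \<partial>lebesgue)"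

end

theory Submission
  imports Defs
begin

text \<open>
  Hedberg's trick: splitting the Riesz kernel at a well-chosen radius bounds the potential of \<open>f\<close>
  pointwise by a multiple of \<open>(M f) powr (1 - \<theta>)\<close> when the \<open>L\<^sup>q\<close> norm of \<open>f\<close> is at most \<open>1\<close>, where
  \<open>M\<close> is the Hardy-Littlewood maximal operator. As \<open>\<sigma> = p / (1 - \<theta>)\<close>, it remains to bound the
  \<open>p\<close>-modular of \<open>M f\<close> when that of \<open>f\<close> is at most \<open>1\<close>. The part of \<open>f\<close> where \<open>\<bar>f\<bar> \<ge> 1\<close> is handled
  by local log-Hoelder continuity, which gives \<open>(M f) powr p \<le> C * (M (\<bar>f\<bar> powr (p / m))) powr m\<close> for
  a constant \<open>m > 1\<close> below \<open>p\<close>. On the part where \<open>\<bar>f\<bar> < 1\<close> the decay condition allows \<open>p\<close> to be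
  replaced by the constant \<open>p\<^sub>\<infinity>\<close>, up to an integrable error. In both cases the classical strong-type
  bound for \<open>M\<close> concludes.
\<close>

section \<open>The Hardy-Littlewood maximal operator\<close>

text \<open>The far part of the kernel is estimated with the constant exponent \<open>q\<close>, not
  with \<open>p\<close>. This is why the power \<open>1 - \<theta>\<close> does not depend on the
  point and the target exponent is a constant multiple of \<open>p\<close>. The obstacle is that
  Jensen's inequality fails when the exponent varies inside a ball: passing from \<open>p x\<close>
  to \<open>p y\<close> costs a power of the mean whose exponent is an oscillation of
  \<open>p\<close>, and neither large nor small means are harmless. A modular at most 1 caps large
  means by a negative power of the radius, which is the size that log-Hoelder continuity tolerates.
  Small values are compared with the weight \<open>(exp 1 + norm x) powr - (d + 1)\<close>: below it
  they are absorbed by an integrable error, above it the decay condition keeps the cost of changing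
  the exponent bounded. The spare factor \<open>m\<close> is there because the maximal operator is
  only of weak type at exponent 1. The estimates are made for functions whose modular and
  \<open>L^q\<close> integral are at most 1. Homogeneity reduces to these, and a constant bound on
  the modular becomes a bound on the norm because the exponents are at least 1.\<close>

text \<open>
  Radii are restricted to powers of \<open>2\<close> to make the supremum countable; the mean is normalised by
  the power of the radius instead of the volume of the ball.
\<close>

definition maximal :: "('a::euclidean_space \<Rightarrow> ennreal) \<Rightarrow> 'a \<Rightarrow> ennreal"
  where "maximal g x =
    (SUP k::int. (\<integral>\<^sup>+y\<in>ball x (2 powr k). g y \<partial>lborel) / ennreal ((2 powr k) ^ DIM('a)))"

text \<open>The ball is a section of one open set in the product space, so the integrand is jointly
  measurable in the centre and the variable.\<close>

lemma borel_measurable_ball_integral [measurable]: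
  fixes g :: "'a::euclidean_space \<Rightarrow> ennreal"
  assumes [measurable]: "g \<in> borel_measurable borel"
  shows "(\<lambda>x. \<integral>\<^sup>+y\<in>ball x r. g y \<partial>lborel) \<in> borel_measurable borel"
proof -
  have "(\<lambda>x. \<integral>\<^sup>+y. g y * indicator (ball x r) y \<partial>lborel) =
        (\<lambda>x. \<integral>\<^sup>+y. g y * indicator {z. dist (fst z) (snd z) < r} (x, y) \<partial>lborel)"
    by (auto intro!: nn_integral_cong simp: indicator_def)
  also have "\<dots> \<in> borel_measurable borel"
    by measurable
  finally show ?thesis .
qed

lemma borel_measurable_maximal [measurable]:
  fixes g :: "'a::euclidean_space \<Rightarrow> ennreal"
  assumes [measurable]: "g \<in> borel_measurable borel"
  shows "maximal g \<in> borel_measurable borel"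
  unfolding maximal_def[abs_def] by measurable

section \<open>Elementary estimates for balls and the maximal function\<close>

lemma emeasure_lborel_ball:
  fixes x :: "'a::euclidean_space"
  assumes "r \<ge> 0"
  shows "emeasure lborel (ball x r) = ennreal (unit_ball_vol DIM('a) * r ^ DIM('a))"
  using emeasure_ball[OF assms, of x] by simp

lemma maximal_mono:
  assumes "\<And>y. g y \<le> h y"
  shows "maximal g x \<le> maximal h x"
  unfolding maximal_def
  by (intro SUP_mono' divide_right_mono_ennreal nn_integral_mono mult_right_mono assms) auto

lemma maximal_add:
  fixes g h :: "'a::euclidean_space \<Rightarrow> ennreal"
  assumes [measurable]: "g \<in> borel_measurable borel" "h \<in> borel_measurable borel"
  shows "maximal (\<lambda>y. g y + h y) x \<le> maximal g x + maximal h x"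
  unfolding maximal_def
proof (rule SUP_least)
  fix k :: int
  let ?A = "\<lambda>g k. (\<integral>\<^sup>+y\<in>ball x (2 powr real_of_int k). g y \<partial>lborel) / ennreal ((2 powr real_of_int k) ^ DIM('a))"
  have "?A (\<lambda>y. g y + h y) k = ?A g k + ?A h k"
  proof -
    have "(\<integral>\<^sup>+y\<in>ball x (2 powr real_of_int k). g y + h y \<partial>lborel) =
      (\<integral>\<^sup>+y\<in>ball x (2 powr real_of_int k). g y \<partial>lborel) + (\<integral>\<^sup>+y\<in>ball x (2 powr real_of_int k). h y \<partial>lborel)"
      unfolding distrib_right
      by (intro nn_integral_add borel_measurable_times_ennreal borel_measurable_indicator) auto
    then show ?thesis by (simp add: add_divide_distrib_ennreal)
  qed
  also have "\<dots> \<le> (SUP k. ?A g k) + (SUP k. ?A h k)"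
    by (intro add_mono SUP_upper) auto
  finally show "?A (\<lambda>y. g y + h y) k \<le> (SUP k. ?A g k) + (SUP k. ?A h k)" .
qed

text \<open>The normalising powers are positive and finite, so the division can be cleared even when
  \<open>A\<close> or the integral is infinite.\<close>

lemma maximal_le_iff:
  fixes g :: "'a::euclidean_space \<Rightarrow> ennreal"
  shows "maximal g x \<le> A \<longleftrightarrow>
    (\<forall>k::int. (\<integral>\<^sup>+y\<in>ball x (2 powr k). g y \<partial>lborel) \<le> A * ennreal ((2 powr k) ^ DIM('a)))"
proof -
  have "(a / ennreal ((2 powr real_of_int k) ^ DIM('a)) \<le> A) = (a \<le> A * ennreal ((2 powr real_of_int k) ^ DIM('a)))"
    for a and k :: int
  proof -
    let ?b = "ennreal ((2 powr real_of_int k) ^ DIM('a))"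
    have b: "?b \<noteq> 0" "?b \<noteq> top" by auto
    then have "a / ?b * ?b = a"
      by (simp add: ennreal_divide_times)
    moreover have "A * ?b / ?b = A"
      using b by (simp add: mult_divide_eq_ennreal)
    ultimately show ?thesis
      by (metis divide_right_mono_ennreal mult_right_mono zero_le)
  qed
  then show ?thesis
    unfolding maximal_def by (simp add: SUP_le_iff)
qed

lemma maximal_const:
  fixes x :: "'a::euclidean_space"
  shows "maximal (\<lambda>_. c) x \<le> c * ennreal (unit_ball_vol DIM('a))"
  unfolding maximal_le_iff
  by (subst nn_integral_cmult_indicator)
    (auto simp: emeasure_lborel_ball ennreal_mult' mult.assoc unit_ball_vol_nonneg)

text \<open>Rounding the radius up to a power of 2 at most doubles it; this is the price of the
  dyadic supremum.\<close>

lemma ball_integral_le_maximal: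
  fixes g :: "'a::euclidean_space \<Rightarrow> ennreal"
  assumes "r > 0"
  shows "(\<integral>\<^sup>+y\<in>ball x r. g y \<partial>lborel) \<le> maximal g x * ennreal ((2 * r) ^ DIM('a))"
proof -
  define k where "k = \<lceil>log 2 r\<rceil>"
  have k: "r \<le> 2 powr k" "2 powr k \<le> 2 * r"
  proof -
    have "r = 2 powr (log 2 r)" using assms by simp
    also have "\<dots> \<le> 2 powr k" unfolding k_def by (intro powr_mono) auto
    finally show "r \<le> 2 powr k" .
    have "2 powr k \<le> 2 powr (log 2 r + 1)" unfolding k_def by (intro powr_mono) auto
    also have "\<dots> = 2 * r" using assms by (simp add: powr_add)
    finally show "2 powr k \<le> 2 * r" .
  qed
  have "(\<integral>\<^sup>+y\<in>ball x r. g y \<partial>lborel) \<le> (\<integral>\<^sup>+y\<in>ball x (2 powr k). g y \<partial>lborel)"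
    using k by (intro nn_integral_mono) (auto simp: indicator_def)
  also have "\<dots> \<le> maximal g x * ennreal ((2 powr k) ^ DIM('a))"
    using maximal_le_iff[of g x "maximal g x"] by auto
  also have "\<dots> \<le> maximal g x * ennreal ((2 * r) ^ DIM('a))"
    using k assms by (intro mult_left_mono ennreal_leI power_mono) auto
  finally show ?thesis .
qed

section \<open>Weak type, strong type and finiteness of the maximal function\<close>

lemma maximal_weak_type:
  fixes g :: "'a::euclidean_space \<Rightarrow> ennreal"
  assumes [measurable]: "g \<in> borel_measurable borel" and l: "l > 0"
  shows "ennreal l * emeasure lborel {x. ennreal l < maximal g x}
    \<le> ennreal (unit_ball_vol DIM('a) * 5 ^ DIM('a)) * (\<integral>\<^sup>+y. g y \<partial>lborel)"
proof -
  let ?d = "DIM('a)"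
  let ?B = "\<lambda>x k. \<integral>\<^sup>+y\<in>ball x (2 powr real_of_int k). g y \<partial>lborel"
  \<comment> \<open>Vitali's covering lemma needs bounded radii. The scales are therefore cut off at
    \<open>2 powr N\<close>, and the level set is recovered as the increasing union of the sets
    \<open>E N\<close>.\<close>
  define E where "E N = {x. \<exists>k::int. k \<le> int N \<and> ennreal l * ennreal ((2 powr k) ^ ?d) < ?B x k}" for N :: nat
  have Em [measurable]: "E N \<in> sets borel" for N
    unfolding E_def by measurable
  have "{x. ennreal l < maximal g x} = (\<Union>N. E N)"
  proof -
    have "ennreal l < maximal g x \<longleftrightarrow> (\<exists>k::int. ennreal l * ennreal ((2 powr k) ^ ?d) < ?B x k)" for x
      using maximal_le_iff[of g x "ennreal l"] by (meson not_le)
    moreover have "k \<le> int (nat k)" for k by simp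
    ultimately show ?thesis unfolding E_def by blast
  qed
  moreover have "incseq E"
    unfolding incseq_def E_def by (intro allI impI subsetI CollectI) (auto intro: order_trans[OF _ of_nat_mono])
  ultimately have lim: "emeasure lborel {x. ennreal l < maximal g x} = (SUP N. emeasure lborel (E N))"
    by (subst SUP_emeasure_incseq) auto
  have "ennreal l * emeasure lborel (E N) \<le> ennreal (unit_ball_vol ?d * 5 ^ ?d) * (\<integral>\<^sup>+y. g y \<partial>lborel)" for N
  proof -
    define K where "K = {(x, k::int). k \<le> int N \<and> ennreal l * ennreal ((2 powr k) ^ ?d) < ?B x k}"
    define r where "r i = 2 powr real_of_int (snd i)" for i :: "'a \<times> int"
    have cover: "E N \<subseteq> (\<Union>i\<in>K. cball (fst i) (r i))"
      unfolding E_def K_def r_def by force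
    have radii: "0 < r i \<and> r i \<le> 2 powr N" if "i \<in> K" for i
      using that unfolding K_def r_def by auto
    obtain C where C: "countable C" "C \<subseteq> K"
      "pairwise (\<lambda>i j. disjnt (cball (fst i) (r i)) (cball (fst j) (r j))) C"
      "E N \<subseteq> (\<Union>i\<in>C. cball (fst i) (5 * r i))"
      \<comment> \<open>The selected balls are disjoint, so the masses of \<open>g\<close> on them
        add up to at most its integral, while their enlargements by 5 still cover
        \<open>E N\<close>. This is the origin of \<open>5 ^ DIM('a)\<close>.\<close>
      by (rule Vitali_covering_lemma_cballs[OF cover radii])
    have disj: "disjoint_family_on (\<lambda>i. ball (fst i) (r i)) C"
      using C(3) unfolding disjoint_family_on_def pairwise_def disjnt_def
      by (meson ball_subset_cball disjoint_iff subsetD)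
    have "emeasure lborel (E N) \<le> emeasure lborel (\<Union>i\<in>C. cball (fst i) (5 * r i))"
      using C by (intro emeasure_mono sets.countable_UN'') auto
    also have "\<dots> \<le> (\<integral>\<^sup>+i. emeasure lborel (cball (fst i) (5 * r i)) \<partial>count_space C)"
    proof -
      have "emeasure lborel (\<Union>i\<in>C. cball (fst i) (5 * r i)) = (\<integral>\<^sup>+x. indicator (\<Union>i\<in>C. cball (fst i) (5 * r i)) x \<partial>lborel)"
        using C by (intro nn_integral_indicator[symmetric] sets.countable_UN'') auto
      also have "\<dots> \<le> (\<integral>\<^sup>+x. (\<integral>\<^sup>+i. indicator (cball (fst i) (5 * r i)) x \<partial>count_space C) \<partial>lborel)"
      proof (rule nn_integral_mono)
        fix x
        show "indicator (\<Union>i\<in>C. cball (fst i) (5 * r i)) x \<le> (\<integral>\<^sup>+i. indicator (cball (fst i) (5 * r i)) x \<partial>count_space C)"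
        proof (cases "x \<in> (\<Union>i\<in>C. cball (fst i) (5 * r i))")
          case True
          then obtain i where i: "i \<in> C" "x \<in> cball (fst i) (5 * r i)" by blast
          have "(1::ennreal) = (\<integral>\<^sup>+j. indicator {i} j \<partial>count_space C)"
            using i by (subst nn_integral_indicator) auto
          also have "\<dots> \<le> (\<integral>\<^sup>+i. indicator (cball (fst i) (5 * r i)) x \<partial>count_space C)"
            using i by (intro nn_integral_mono) (auto simp: indicator_def)
          finally show ?thesis using True by simp
        qed simp
      qed
      also have "\<dots> = (\<integral>\<^sup>+i. (\<integral>\<^sup>+x. indicator (cball (fst i) (5 * r i)) x \<partial>lborel) \<partial>count_space C)"
        using C by (intro nn_integral_count_space_nn_integral borel_measurable_indicator) auto
      finally show ?thesis by simp
    qed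
    finally have "ennreal l * emeasure lborel (E N)
      \<le> ennreal l * (\<integral>\<^sup>+i. emeasure lborel (cball (fst i) (5 * r i)) \<partial>count_space C)"
      by (rule mult_left_mono) simp
    also have "\<dots> = (\<integral>\<^sup>+i. ennreal (unit_ball_vol ?d * 5 ^ ?d) * (ennreal l * ennreal (r i ^ ?d)) \<partial>count_space C)"
      using l by (subst nn_integral_cmult[symmetric])
        (auto intro!: nn_integral_cong simp: emeasure_cball r_def power_mult_distrib ennreal_mult'[symmetric] unit_ball_vol_nonneg mult_ac)
    also have "\<dots> \<le> (\<integral>\<^sup>+i. ennreal (unit_ball_vol ?d * 5 ^ ?d) * (\<integral>\<^sup>+y\<in>ball (fst i) (r i). g y \<partial>lborel) \<partial>count_space C)"
      using C(2) by (intro nn_integral_mono mult_left_mono) (auto simp: K_def r_def intro: less_imp_le)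
    \<comment> \<open>Viewed as values of the measure with density \<open>g\<close>, the masses of
      the disjoint balls are summed by countable additivity.\<close>
    also have "\<dots> = ennreal (unit_ball_vol ?d * 5 ^ ?d) * (\<integral>\<^sup>+i. emeasure (density lborel g) (ball (fst i) (r i)) \<partial>count_space C)"
      by (subst nn_integral_cmult[symmetric]) (auto intro!: nn_integral_cong simp: emeasure_density)
    also have "(\<integral>\<^sup>+i. emeasure (density lborel g) (ball (fst i) (r i)) \<partial>count_space C) =
      emeasure (density lborel g) (\<Union>i\<in>C. ball (fst i) (r i))"
      using C disj by (intro emeasure_UN_countable[symmetric]) auto
    also have "\<dots> \<le> emeasure (density lborel g) (space (density lborel g))"
      by (rule emeasure_space)
    also have "\<dots> = (\<integral>\<^sup>+y. g y \<partial>lborel)"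
      by (simp add: emeasure_density)
    finally show ?thesis by (simp add: mult_left_mono)
  qed
  then show ?thesis
    unfolding lim by (simp add: SUP_mult_left_ennreal SUP_le_iff)
qed


text \<open>The values of \<open>g\<close> up to \<open>l / (2 * W)\<close> contribute at most
  \<open>l / 2\<close> to the maximal function, because in this normalisation a constant
  \<open>c\<close> has maximal function at most \<open>c * W\<close>. So the larger values alone
  must exceed \<open>l / 2\<close>, and the plain weak-type bound at that level gives the factor 2.
  Discarding the small values is what makes interpolation possible.\<close>

lemma maximal_weak_type_truncated:
  fixes g :: "'a::euclidean_space \<Rightarrow> real"
  defines "W \<equiv> unit_ball_vol (real DIM('a))"
  assumes [measurable]: "g \<in> borel_measurable borel" and l: "l > 0"
  shows "ennreal l * emeasure lborel {x. ennreal l < maximal (\<lambda>y. ennreal (g y)) x}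
    \<le> ennreal (2 * W * 5 ^ DIM('a)) * (\<integral>\<^sup>+y. ennreal (g y) * indicator {y. l < 2 * W * g y} y \<partial>lborel)"
proof -
  have W: "W > 0" unfolding W_def by simp
  define h where "h y = ennreal (g y) * indicator {y. l < 2 * W * g y} y" for y
  have hm [measurable]: "h \<in> borel_measurable borel"
    unfolding h_def[abs_def] by measurable
  have le: "maximal (\<lambda>y. ennreal (g y)) x \<le> maximal h x + ennreal (l / 2)" for x
  proof -
    have "maximal (\<lambda>y. ennreal (g y)) x \<le> maximal (\<lambda>y. h y + ennreal (l / (2 * W))) x"
    proof (rule maximal_mono)
      fix y
      show "ennreal (g y) \<le> h y + ennreal (l / (2 * W))"
        using W l by (cases "l < 2 * W * g y")
          (auto simp: h_def indicator_def field_simps intro!: ennreal_leI)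
    qed
    also have "\<dots> \<le> maximal h x + maximal (\<lambda>_. ennreal (l / (2 * W))) x"
      by (intro maximal_add) auto
    also have "\<dots> \<le> maximal h x + ennreal (l / (2 * W)) * ennreal W"
      unfolding W_def by (intro add_left_mono maximal_const)
    also have "ennreal (l / (2 * W)) * ennreal W = ennreal (l / 2)"
      using W l by (subst ennreal_mult[symmetric]) auto
    finally show ?thesis .
  qed
  have "{x. ennreal l < maximal (\<lambda>y. ennreal (g y)) x} \<subseteq> {x. ennreal (l / 2) < maximal h x}"
  proof (intro subsetI CollectI, unfold mem_Collect_eq, rule ccontr)
    fix x
    assume *: "ennreal l < maximal (\<lambda>y. ennreal (g y)) x" "\<not> ennreal (l / 2) < maximal h x"
    have "maximal (\<lambda>y. ennreal (g y)) x \<le> maximal h x + ennreal (l / 2)" by (rule le)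
    also have "\<dots> \<le> ennreal (l / 2) + ennreal (l / 2)"
      using * by (intro add_right_mono) (simp add: not_less)
    also have "\<dots> = ennreal l"
      using l by (subst ennreal_plus[symmetric]) auto
    finally show False using *(1) by simp
  qed
  then have "ennreal l * emeasure lborel {x. ennreal l < maximal (\<lambda>y. ennreal (g y)) x}
    \<le> ennreal 2 * ennreal (l / 2) * emeasure lborel {x. ennreal (l / 2) < maximal h x}"
    using l by (subst ennreal_mult[symmetric]) (auto intro!: mult_left_mono emeasure_mono)
  also have "\<dots> \<le> ennreal 2 * (ennreal (W * 5 ^ DIM('a)) * (\<integral>\<^sup>+y. h y \<partial>lborel))"
    unfolding W_def using maximal_weak_type[of h "l / 2"] l hm
    by (simp add: mult.assoc mult_left_mono)
  also have "\<dots> = ennreal (2 * W * 5 ^ DIM('a)) * (\<integral>\<^sup>+y. h y \<partial>lborel)"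
    using W by (subst mult.assoc[symmetric], subst ennreal_mult[symmetric]) (auto simp: mult.assoc)
  finally show ?thesis by (simp add: h_def)
qed

text \<open>The layer-cake identity at a single point. Combined with Fubini it turns the integral of
  a power into an integral over the measures of level sets; the open interval matches the strict
  inequalities in those sets.\<close>

lemma nn_integral_powr_layer:
  assumes "0 \<le> t" "0 < r"
  shows "(\<integral>\<^sup>+l. ennreal (r * l powr (r - 1)) * indicator {0<..<t} l \<partial>lborel) = ennreal (t powr r)"
proof -
  have "((\<lambda>l. r * l powr (r - 1)) has_integral r * (t powr (r - 1 + 1) / (r - 1 + 1))) {0..t}"
    using assms by (intro has_integral_mult_right has_integral_powr_from_0) auto
  then have "((\<lambda>l. r * l powr (r - 1)) has_integral t powr r) {0..t}"
    using assms by simp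
  then have "((\<lambda>l. r * l powr (r - 1) * indicator {0..t} l) has_integral t powr r) UNIV"
    by (subst (asm) has_integral_restrict_UNIV[symmetric])
      (auto simp: indicator_def elim!: has_integral_eq[rotated])
  then have "(\<integral>\<^sup>+l. ennreal (r * l powr (r - 1) * indicator {0..t} l) \<partial>lborel) = ennreal (t powr r)"
    using assms by (intro nn_integral_has_integral_lborel) auto
  also have "(\<integral>\<^sup>+l. ennreal (r * l powr (r - 1) * indicator {0..t} l) \<partial>lborel) =
    (\<integral>\<^sup>+l. ennreal (r * l powr (r - 1)) * indicator {0<..<t} l \<partial>lborel)"
  proof (rule nn_integral_cong_AE)
    have "AE l in lborel. l \<noteq> 0" "AE l in lborel. l \<noteq> t"
      by (rule AE_lborel_singleton)+
    then show "AE l in lborel. ennreal (r * l powr (r - 1) * indicator {0..t} l) =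
      ennreal (r * l powr (r - 1)) * indicator {0<..<t} l"
      by eventually_elim (auto simp: indicator_def)
  qed
  finally show ?thesis .
qed

text \<open>The constant of Marcinkiewicz interpolation: \<open>2 * W * 5 ^ DIM('a)\<close> comes
  from the truncated weak-type bound, and the last factor is the integral of
  \<open>r * l powr (r - 2)\<close> over \<open>0 < l < 2 * W\<close>. The first argument only
  carries the dimension.\<close>

definition strong_constant :: "'a::euclidean_space itself \<Rightarrow> real \<Rightarrow> real"
  where "strong_constant _ r =
    (let W = unit_ball_vol (real DIM('a)) in 2 * W * 5 ^ DIM('a) * (r / (r - 1) * (2 * W) powr (r - 1)))"

lemma strong_constant_pos: "r > 1 \<Longrightarrow> strong_constant TYPE('a::euclidean_space) r > 0"
  using unit_ball_vol_pos[of "real DIM('a)"]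
  unfolding strong_constant_def Let_def
  by (intro mult_pos_pos divide_pos_pos) (simp_all del: unit_ball_vol_pos)

text \<open>Marcinkiewicz interpolation between the weak-type bound and the trivial bound for
  bounded functions. As \<open>enn2real\<close> sends infinity to 0, the inequality is silent about
  points where the maximal function is infinite; \<open>AE_maximal_finite\<close> shows that they
  form a null set.\<close>

lemma maximal_strong_type:
  fixes g :: "'a::euclidean_space \<Rightarrow> real"
  assumes gm [measurable]: "g \<in> borel_measurable borel" and g0: "\<And>y. g y \<ge> 0" and r: "r > 1"
  shows "(\<integral>\<^sup>+x. ennreal (enn2real (maximal (\<lambda>y. ennreal (g y)) x) powr r) \<partial>lborel)
    \<le> ennreal (strong_constant TYPE('a) r) * (\<integral>\<^sup>+y. ennreal (g y powr r) \<partial>lborel)"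
proof -
  let ?M = "maximal (\<lambda>y. ennreal (g y))"
  define W where "W = unit_ball_vol (real DIM('a))"
  define c where "c = 2 * W * 5 ^ DIM('a)"
  have W: "W > 0" unfolding W_def by simp
  have c: "c > 0" unfolding c_def using W by simp
  define F where "F x = enn2real (?M x)" for x
  have F [measurable]: "F \<in> borel_measurable borel" unfolding F_def[abs_def] by measurable
  have F0: "F x \<ge> 0" for x unfolding F_def by simp
  have "(\<integral>\<^sup>+x. ennreal (F x powr r) \<partial>lborel) =
    (\<integral>\<^sup>+x. (\<integral>\<^sup>+l. ennreal (r * l powr (r - 1)) * indicator {0<..<F x} l \<partial>lborel) \<partial>lborel)"
    using r F0 by (subst nn_integral_powr_layer) auto
  also have "\<dots> = (\<integral>\<^sup>+x. (\<integral>\<^sup>+l. ennreal (r * l powr (r - 1)) * indicator {p. 0 < snd p \<and> snd p < F (fst p)} (x, l) \<partial>lborel) \<partial>lborel)"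
    by (intro nn_integral_cong) (auto simp: indicator_def)
  also have "\<dots> = (\<integral>\<^sup>+l. (\<integral>\<^sup>+x. ennreal (r * l powr (r - 1)) * indicator {p. 0 < snd p \<and> snd p < F (fst p)} (x, l) \<partial>lborel) \<partial>lborel)"
    by (rule lborel_pair.Fubini'[symmetric]) measurable
  also have "\<dots> \<le> (\<integral>\<^sup>+l. (\<integral>\<^sup>+y. ennreal (r * l powr (r - 2)) * indicator {0<..} l * (ennreal c * (ennreal (g y) * indicator {p. snd p < 2 * W * g (fst p)} (y, l))) \<partial>lborel) \<partial>lborel)"
  proof (rule nn_integral_mono)
    fix l :: real
    show "(\<integral>\<^sup>+x. ennreal (r * l powr (r - 1)) * indicator {p. 0 < snd p \<and> snd p < F (fst p)} (x, l) \<partial>lborel)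
      \<le> (\<integral>\<^sup>+y. ennreal (r * l powr (r - 2)) * indicator {0<..} l * (ennreal c * (ennreal (g y) * indicator {p. snd p < 2 * W * g (fst p)} (y, l))) \<partial>lborel)"
    proof (cases "l > 0")
      case l: True
      have "(\<integral>\<^sup>+x. ennreal (r * l powr (r - 1)) * indicator {p. 0 < snd p \<and> snd p < F (fst p)} (x, l) \<partial>lborel)
        = (\<integral>\<^sup>+x. ennreal (r * l powr (r - 1)) * indicator {x. l < F x} x \<partial>lborel)"
        using l by (intro nn_integral_cong) (auto simp: indicator_def)
      also have "\<dots> = ennreal (r * l powr (r - 1)) * emeasure lborel {x. l < F x}"
        by (subst nn_integral_cmult_indicator) auto
      also have "\<dots> \<le> ennreal (r * l powr (r - 1)) * emeasure lborel {x. ennreal l < ?M x}"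
      proof (intro mult_left_mono emeasure_mono)
        \<comment> \<open>Where \<open>?M x\<close> is infinite, \<open>F x\<close> is 0 and the
          premise \<open>l < F x\<close> fails, since \<open>l > 0\<close>.\<close>
        show "{x. l < F x} \<subseteq> {x. ennreal l < ?M x}"
        proof safe
          fix x assume "l < F x"
          then show "ennreal l < ?M x"
            unfolding F_def using l by (cases "?M x") (auto simp: ennreal_less_iff)
        qed
      qed auto
      also have "\<dots> = ennreal (r * l powr (r - 2)) * (ennreal l * emeasure lborel {x. ennreal l < ?M x})"
      proof -
        have "r * l powr (r - 1) = r * l powr (r - 2) * l"
          using l by (simp add: powr_diff power2_eq_square powr_numeral)
        then show ?thesis
          using l r by (simp add: ennreal_mult mult.assoc)
      qed
      also have "\<dots> \<le> ennreal (r * l powr (r - 2)) * (ennreal c * (\<integral>\<^sup>+y. ennreal (g y) * indicator {y. l < 2 * W * g y} y \<partial>lborel))"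
        unfolding c_def W_def using maximal_weak_type_truncated[OF gm l] by (intro mult_left_mono) auto
      also have "\<dots> = (\<integral>\<^sup>+y. ennreal (r * l powr (r - 2)) * (ennreal c * (ennreal (g y) * indicator {y. l < 2 * W * g y} y)) \<partial>lborel)"
        by (simp add: nn_integral_cmult)
      also have "\<dots> = (\<integral>\<^sup>+y. ennreal (r * l powr (r - 2)) * indicator {0<..} l * (ennreal c * (ennreal (g y) * indicator {p. snd p < 2 * W * g (fst p)} (y, l))) \<partial>lborel)"
        using l by (intro nn_integral_cong) (auto simp: indicator_def)
      finally show ?thesis .
    qed (auto simp: indicator_def)
  qed
  \<comment> \<open>With the order exchanged, the truncation limits the inner integral to
    \<open>0 < l < 2 * W * g y\<close>. It converges at 0 because \<open>r > 1\<close> and gives a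
    multiple of \<open>g y powr (r - 1)\<close>.\<close>
  also have "\<dots> = (\<integral>\<^sup>+y. (\<integral>\<^sup>+l. ennreal (r * l powr (r - 2)) * indicator {0<..} l * (ennreal c * (ennreal (g y) * indicator {p. snd p < 2 * W * g (fst p)} (y, l))) \<partial>lborel) \<partial>lborel)"
    by (rule lborel_pair.Fubini') measurable
  also have "\<dots> = (\<integral>\<^sup>+y. ennreal (strong_constant TYPE('a) r) * ennreal (g y powr r) \<partial>lborel)"
  proof (rule nn_integral_cong)
    fix y
    have "(\<integral>\<^sup>+l. ennreal (r * l powr (r - 2)) * indicator {0<..} l * (ennreal c * (ennreal (g y) * indicator {p. snd p < 2 * W * g (fst p)} (y, l))) \<partial>lborel)
      = (\<integral>\<^sup>+l. ennreal (c * g y * (r / (r - 1))) * (ennreal ((r - 1) * l powr (r - 1 - 1)) * indicator {0<..<2 * W * g y} l) \<partial>lborel)"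
    proof (intro nn_integral_cong)
      fix l :: real
      have "ennreal (r * l powr (r - 2)) * (ennreal c * ennreal (g y)) =
        ennreal (c * g y * (r / (r - 1))) * ennreal ((r - 1) * l powr (r - 1 - 1))"
      proof -
        have "c * g y * (r / (r - 1)) * ((r - 1) * l powr (r - 1 - 1)) = r * l powr (r - 2) * (c * g y)"
          using r by simp
        then show ?thesis
          using r c g0[of y] by (simp only: ennreal_mult[symmetric]) (simp add: ennreal_mult[symmetric])
      qed
      then show "ennreal (r * l powr (r - 2)) * indicator {0<..} l * (ennreal c * (ennreal (g y) * indicator {p. snd p < 2 * W * g (fst p)} (y, l)))
        = ennreal (c * g y * (r / (r - 1))) * (ennreal ((r - 1) * l powr (r - 1 - 1)) * indicator {0<..<2 * W * g y} l)"
        by (auto simp: indicator_def)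
    qed
    also have "\<dots> = ennreal (c * g y * (r / (r - 1))) * ennreal ((2 * W * g y) powr (r - 1))"
      using r W g0[of y] by (subst nn_integral_cmult, simp, subst nn_integral_powr_layer) auto
    also have "\<dots> = ennreal (c * g y * (r / (r - 1)) * (2 * W * g y) powr (r - 1))"
      using r c g0 by (subst ennreal_mult) auto
    also have "c * g y * (r / (r - 1)) * (2 * W * g y) powr (r - 1) = strong_constant TYPE('a) r * g y powr r"
    proof (cases "g y = 0")
      case False
      then have "g y > 0" using g0[of y] by simp
      then have "g y powr r = g y * g y powr (r - 1)"
        by (simp add: powr_diff)
      then show ?thesis
        using W \<open>g y > 0\<close> by (simp add: strong_constant_def Let_def c_def W_def powr_mult)
    qed (use r in simp)
    finally show "(\<integral>\<^sup>+l. ennreal (r * l powr (r - 2)) * indicator {0<..} l * (ennreal c * (ennreal (g y) * indicator {p. snd p < 2 * W * g (fst p)} (y, l))) \<partial>lborel)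
      = ennreal (strong_constant TYPE('a) r) * ennreal (g y powr r)"
      using strong_constant_pos[OF r, where 'a='a] by (simp add: ennreal_mult)
  qed
  finally show ?thesis
    unfolding F_def by (simp add: nn_integral_cmult)
qed

text \<open>The set of infinite values lies in every level set. The truncated weak-type bound, in
  which \<open>l\<close> is at most \<open>2 * W * g\<close>, makes its measure at most a constant
  times \<open>l powr - r\<close>, and \<open>l\<close> is arbitrary.\<close>

lemma AE_maximal_finite:
  fixes g :: "'a::euclidean_space \<Rightarrow> real"
  assumes gm [measurable]: "g \<in> borel_measurable borel" and g0: "\<And>y. g y \<ge> 0" and r: "r > 1"
    and fin: "(\<integral>\<^sup>+y. ennreal (g y powr r) \<partial>lborel) < \<infinity>"
  shows "AE x in lborel. maximal (\<lambda>y. ennreal (g y)) x < \<infinity>"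
proof -
  let ?M = "maximal (\<lambda>y. ennreal (g y))"
  define W where "W = unit_ball_vol (real DIM('a))"
  define c where "c = 2 * W * 5 ^ DIM('a)"
  have W: "W > 0" unfolding W_def by simp
  have c: "c > 0" unfolding c_def using W by simp
  define I where "I = enn2real (\<integral>\<^sup>+y. ennreal (g y powr r) \<partial>lborel)"
  have I: "(\<integral>\<^sup>+y. ennreal (g y powr r) \<partial>lborel) = ennreal I"
    using fin unfolding I_def by simp
  have I0: "I \<ge> 0" unfolding I_def by simp
  define S where "S = {x. ?M x = \<infinity>}"
  have S [measurable]: "S \<in> sets borel" unfolding S_def by measurable
  define D where "D = c * (2 * W) powr (r - 1) * I"
  have D0: "D \<ge> 0" unfolding D_def using c I0 by simp
  have main: "ennreal (l powr r) * emeasure lborel S \<le> ennreal D" if l: "l > 0" for l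
  proof -
    have "ennreal l * emeasure lborel S \<le> ennreal l * emeasure lborel {x. ennreal l < ?M x}"
      by (intro mult_left_mono emeasure_mono) (auto simp: S_def less_top)
    also have "\<dots> \<le> ennreal c * (\<integral>\<^sup>+y. ennreal (g y) * indicator {y. l < 2 * W * g y} y \<partial>lborel)"
      unfolding c_def W_def by (rule maximal_weak_type_truncated[OF gm l])
    finally have "ennreal (l powr (r - 1)) * (ennreal l * emeasure lborel S)
      \<le> ennreal (l powr (r - 1)) * (ennreal c * (\<integral>\<^sup>+y. ennreal (g y) * indicator {y. l < 2 * W * g y} y \<partial>lborel))"
      by (rule mult_left_mono) simp
    also have "\<dots> = ennreal c * (\<integral>\<^sup>+y. ennreal (l powr (r - 1)) * (ennreal (g y) * indicator {y. l < 2 * W * g y} y) \<partial>lborel)"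
      by (subst nn_integral_cmult) (auto simp: mult_ac)
    also have "\<dots> \<le> ennreal c * (\<integral>\<^sup>+y. ennreal ((2 * W) powr (r - 1)) * ennreal (g y powr r) \<partial>lborel)"
    proof (intro mult_left_mono nn_integral_mono)
      fix y
      show "ennreal (l powr (r - 1)) * (ennreal (g y) * indicator {y. l < 2 * W * g y} y)
        \<le> ennreal ((2 * W) powr (r - 1)) * ennreal (g y powr r)"
      proof (cases "l < 2 * W * g y")
        case True
        then have gp: "g y > 0" using l W
          by (metis less_trans mult_pos_pos zero_less_mult_pos zero_less_numeral)
        have "l powr (r - 1) * g y \<le> (2 * W * g y) powr (r - 1) * g y"
          using True l r gp by (intro mult_right_mono powr_mono2) auto
        also have "\<dots> = (2 * W) powr (r - 1) * g y powr r"
          using W gp by (simp add: powr_mult powr_diff)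
        finally show ?thesis
          using True gp by (simp add: ennreal_mult'[symmetric] ennreal_leI)
      qed auto
    qed auto
    also have "\<dots> = ennreal D"
      unfolding D_def using c I0 I by (simp add: nn_integral_cmult ennreal_mult mult.assoc)
    finally show ?thesis
      using l by (simp add: mult.assoc[symmetric] ennreal_mult[symmetric] powr_diff)
  qed
  have "emeasure lborel S \<le> 0"
  proof (rule ennreal_le_epsilon)
    fix e :: real assume e: "e > 0"
    \<comment> \<open>At this level the bound is \<open>e * D / (D + 1)\<close>; the summand 1 keeps
      \<open>l\<close> positive when \<open>D = 0\<close>.\<close>
    define l where "l = ((D + 1) / e) powr (1 / r)"
    have l: "l > 0" unfolding l_def using e D0 by simp
    have lr: "l powr r = (D + 1) / e" unfolding l_def using e D0 r by (simp add: powr_powr)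
    have "emeasure lborel S = ennreal (e / (D + 1)) * (ennreal (l powr r) * emeasure lborel S)"
      unfolding lr using e D0 by (simp add: mult.assoc[symmetric] ennreal_mult[symmetric])
    also have "\<dots> \<le> ennreal (e / (D + 1)) * ennreal D"
      by (intro mult_left_mono main l) auto
    also have "\<dots> = ennreal (e / (D + 1) * D)"
      using e D0 by (intro ennreal_mult[symmetric]) auto
    also have "\<dots> \<le> ennreal e"
      using e D0 by (intro ennreal_leI) (auto simp: field_simps)
    finally show "emeasure lborel S \<le> 0 + ennreal e" by simp
  qed
  then have "S \<in> null_sets lborel" by (auto simp: null_sets_def)
  then have "AE x in lborel. x \<notin> S" by (rule AE_not_in)
  then show ?thesis by eventually_elim (auto simp: S_def less_top)
qed

section \<open>Variable exponents\<close>

lemma dyadic_bracket: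
  fixes t :: real
  assumes "1 \<le> t"
  obtains i :: nat where "2 ^ i \<le> t" "t < 2 ^ Suc i"
proof
  define i where "i = nat \<lfloor>log 2 t\<rfloor>"
  have l: "log 2 t \<ge> 0" using assms by simp
  have t: "2 powr (log 2 t) = t" using assms by simp
  have "2 ^ i = 2 powr (real i)" by (simp add: powr_realpow)
  also have "\<dots> \<le> 2 powr (log 2 t)" unfolding i_def using l by (intro powr_mono) auto
  finally show "2 ^ i \<le> t" using t by simp
  have "2 powr (log 2 t) < 2 powr (real (Suc i))"
    unfolding i_def using l by (intro powr_less_mono) linarith+
  also have "\<dots> = 2 ^ Suc i" by (rule powr_realpow) simp
  finally show "t < 2 ^ Suc i" using t by simp
qed

lemma suminf_ennreal_geometric:
  assumes "0 \<le> c" "0 < q" "q < 1"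
  shows "(\<Sum>i. ennreal (c * q ^ i)) = ennreal (c / (1 - q))"
proof -
  have "(\<lambda>i. c * q ^ i) sums (c * (1 / (1 - q)))"
    using assms by (intro sums_mult geometric_sums) auto
  then show ?thesis
    using assms by (intro suminf_ennreal_eq) auto
qed

lemma le_suminf_ennreal: "f i \<le> (\<Sum>i. f i :: ennreal)"
  using sum_le_suminf[of f "{i}"] by simp

text \<open>Cover space by dyadic balls: the volume of the ball number \<open>i\<close> grows like
  \<open>2 ^ (i * d)\<close> while the weight needed there is \<open>2 ^ (- i * (d + 1))\<close>.
  The extra 1 in the exponent leaves a geometric series of ratio 1/2.\<close>

lemma nn_integral_decay_finite:
  "(\<integral>\<^sup>+x. ennreal ((exp 1 + norm (x::'a::euclidean_space)) powr - (real DIM('a) + 1)) \<partial>lborel) < \<infinity>"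
proof -
  let ?d = "DIM('a)"
  let ?W = "unit_ball_vol (real ?d)"
  let ?c = "\<lambda>i::nat. (1 / 2 ^ i) ^ (?d + 1) :: real"
  have "(\<integral>\<^sup>+x. ennreal ((exp 1 + norm (x::'a)) powr - (real ?d + 1)) \<partial>lborel)
    \<le> (\<integral>\<^sup>+x. (\<Sum>i. ennreal (?c i) * indicator (ball 0 (2 ^ Suc i)) (x::'a)) \<partial>lborel)"
  proof (rule nn_integral_mono)
    fix x :: 'a
    obtain i where i: "2 ^ i \<le> 1 + norm x" "1 + norm x < 2 ^ Suc i"
      using dyadic_bracket[of "1 + norm x"] by auto
    have "exp 1 + norm x \<ge> 1 + norm x" using exp_ge_add_one_self[of "1::real"] by linarith
    then have "(exp 1 + norm x) powr - (real ?d + 1) \<le> (2 ^ i) powr - (real ?d + 1)"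
      using i by (intro powr_mono2') (auto intro: order_trans)
    also have "\<dots> = ?c i"
    proof -
      have "(2 ^ i) powr real (?d + 1) = ((2 ^ i) ^ (?d + 1) :: real)"
        by (rule powr_realpow) simp
      moreover have "- (real ?d + 1) = - real (?d + 1)" by simp
      ultimately show ?thesis
        by (simp only: powr_minus inverse_eq_divide power_one_over)
    qed
    finally have "ennreal ((exp 1 + norm x) powr - (real ?d + 1)) \<le> ennreal (?c i) * indicator (ball 0 (2 ^ Suc i)) x"
      using i by (auto simp: indicator_def intro!: ennreal_leI)
    also have "\<dots> \<le> (\<Sum>i. ennreal (?c i) * indicator (ball 0 (2 ^ Suc i)) x)"
      by (rule le_suminf_ennreal)
    finally show "ennreal ((exp 1 + norm x) powr - (real ?d + 1))
      \<le> (\<Sum>i. ennreal (?c i) * indicator (ball 0 (2 ^ Suc i)) x)" .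
  qed
  also have "\<dots> = (\<Sum>i. \<integral>\<^sup>+x. ennreal (?c i) * indicator (ball 0 (2 ^ Suc i)) (x::'a) \<partial>lborel)"
    by (intro nn_integral_suminf borel_measurable_times_ennreal borel_measurable_indicator) auto
  also have "\<dots> = (\<Sum>i. ennreal ((?W * 2 ^ ?d) * (1 / 2) ^ i))"
  proof (rule suminf_cong)
    fix i
    have "(\<integral>\<^sup>+x. ennreal (?c i) * indicator (ball 0 (2 ^ Suc i)) (x::'a) \<partial>lborel)
      = ennreal (?c i) * ennreal (?W * (2 ^ Suc i) ^ ?d)"
      by (subst nn_integral_cmult_indicator) (auto simp: emeasure_lborel_ball)
    also have "\<dots> = ennreal (?c i * (?W * (2 ^ Suc i) ^ ?d))"
      by (intro ennreal_mult[symmetric]) auto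
    also have "?c i * (?W * (2 ^ Suc i) ^ ?d) = (?W * 2 ^ ?d) * (1 / 2) ^ i"
      by (simp add: power_mult_distrib power_divide field_simps)
    finally show "(\<integral>\<^sup>+x. ennreal (?c i) * indicator (ball 0 (2 ^ Suc i)) (x::'a) \<partial>lborel) =
      ennreal ((?W * 2 ^ ?d) * (1 / 2) ^ i)" .
  qed
  also have "\<dots> = ennreal ((?W * 2 ^ ?d) / (1 - 1 / 2))"
    by (rule suminf_ennreal_geometric) auto
  finally show ?thesis
    using le_less_trans ennreal_less_top by fastforce
qed

text \<open>If \<open>t < R powr - N\<close>, then \<open>t powr a\<close> is at most
  \<open>t\<close> and is absorbed by the error. Otherwise \<open>- ln t\<close> is at most
  \<open>N * ln R\<close>, so the quotient of the two powers is at most \<open>exp (N * K)\<close>.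
  It is applied with \<open>R = exp 1 + norm x\<close> and with \<open>N\<close> large enough to
  make the error integrable.\<close>

lemma powr_exponent_change:
  fixes t a b R K N :: real
  assumes t: "0 \<le> t" "t \<le> 1" and a: "1 \<le> a" and R: "1 \<le> R" and N: "0 \<le> N"
    and K: "\<bar>a - b\<bar> * ln R \<le> K"
  shows "t powr a \<le> exp (N * K) * t powr b + R powr - N"
proof (cases "t < R powr - N")
  case True
  have "t powr a \<le> t powr 1"
    using t a by (intro powr_mono') auto
  also have "\<dots> \<le> R powr - N" using True t by simp
  finally show ?thesis
    using add_increasing[of "exp (N * K) * t powr b" "t powr a" "R powr - N"] by simp
next
  case False
  moreover have Rp: "R powr - N > 0" using R by simp
  ultimately have tp: "t > 0" by linarith
  have "- (N * ln R) \<le> ln t"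
  proof -
    have "ln (R powr - N) \<le> ln t" using False Rp tp by (subst ln_le_cancel_iff) auto
    then show ?thesis using R by (simp add: ln_powr)
  qed
  then have "- ln t \<le> N * ln R" by simp
  have "(a - b) * ln t \<le> \<bar>a - b\<bar> * (- ln t)"
  proof -
    have "ln t \<le> 0" using t tp by simp
    then show ?thesis
      by (cases "a \<ge> b") (auto simp: mult_right_mono_neg algebra_simps)
  qed
  also have "\<dots> \<le> \<bar>a - b\<bar> * (N * ln R)"
    using \<open>- ln t \<le> N * ln R\<close> by (intro mult_left_mono) auto
  also have "\<dots> \<le> N * K"
    using mult_left_mono[OF K N] by (simp add: mult_ac)
  finally have "t powr (a - b) \<le> exp (N * K)"
    using tp by (simp add: powr_def)
  then have "t powr b * t powr (a - b) \<le> t powr b * exp (N * K)"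
    by (intro mult_left_mono) auto
  then have "t powr a \<le> exp (N * K) * t powr b"
    by (simp add: powr_add[symmetric] mult.commute)
  then show ?thesis using Rp by linarith
qed

text \<open>The exponent is changed twice: from \<open>P\<close> to the constant \<open>Pinf\<close>
  on the maximal function, and, after the classical bound in the constant exponent, from
  \<open>Pinf\<close> back to \<open>P\<close> on \<open>g\<close>. Each change contributes one
  factor \<open>exp (N * K)\<close> and one error \<open>J\<close>.\<close>

lemma nn_integral_maximal_bounded_part:
  fixes g P :: "'a::euclidean_space \<Rightarrow> real"
  assumes [measurable]: "g \<in> borel_measurable borel" "P \<in> borel_measurable borel"
    and P: "\<And>x. 1 \<le> P x" "\<And>x. P x \<le> U" and Pinf: "1 < Pinf"
    and decay: "\<And>x. \<bar>P x - Pinf\<bar> * ln (exp 1 + norm x) \<le> K"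
    and g: "\<And>y. 0 \<le> g y" "\<And>y. g y \<le> 1"
    and mod: "(\<integral>\<^sup>+y. ennreal (g y powr P y) \<partial>lborel) \<le> 1"
  defines "N \<equiv> real DIM('a) + 1"
  defines "V \<equiv> max 1 (unit_ball_vol (real DIM('a)))"
  defines "J \<equiv> (\<integral>\<^sup>+x. ennreal ((exp 1 + norm (x::'a)) powr - N) \<partial>lborel)"
  shows "(\<integral>\<^sup>+x. ennreal (enn2real (maximal (\<lambda>y. ennreal (g y)) x) powr P x) \<partial>lborel)
    \<le> ennreal (V powr U) * (ennreal (exp (N * K)) * (ennreal (strong_constant TYPE('a) Pinf) * (ennreal (exp (N * K)) + J)) + J)"
    and "\<And>x. maximal (\<lambda>y. ennreal (g y)) x < \<infinity>"
proof -
  let ?M = "maximal (\<lambda>y. ennreal (g y))"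
  let ?h = "\<lambda>x::'a. (exp 1 + norm x) powr - N"
  have e1: "exp 1 + norm x \<ge> 1" for x :: 'a
    using exp_ge_add_one_self[of "1::real"] norm_ge_zero[of x] by linarith
  have N: "N \<ge> 0" unfolding N_def by simp
  have V: "V \<ge> 1" unfolding V_def by simp
  have MV: "?M x \<le> ennreal V" for x
  proof -
    have "?M x \<le> maximal (\<lambda>_. ennreal 1) x"
      using g by (intro maximal_mono ennreal_leI) auto
    also have "\<dots> \<le> ennreal 1 * ennreal (unit_ball_vol (real DIM('a)))"
      by (rule maximal_const)
    also have "\<dots> \<le> ennreal V" unfolding V_def by (simp add: ennreal_leI)
    finally show ?thesis .
  qed
  then show "?M x < \<infinity>" for x
    using le_less_trans ennreal_less_top by (metis infinity_ennreal_def)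
  define F where "F x = enn2real (?M x)" for x
  have Fm [measurable]: "F \<in> borel_measurable borel" unfolding F_def[abs_def] by measurable
  have F: "0 \<le> F x" "F x \<le> V" for x
    unfolding F_def using MV[of x] V by (auto intro: enn2real_leI)
  have "(\<integral>\<^sup>+x. ennreal (F x powr P x) \<partial>lborel)
    \<le> (\<integral>\<^sup>+x. ennreal (V powr U) * (ennreal (exp (N * K)) * ennreal (F x powr Pinf) + ennreal (?h x)) \<partial>lborel)"
  proof (rule nn_integral_mono)
    fix x
    \<comment> \<open>The change of exponent needs values in the unit interval, whereas
      \<open>F\<close> is only bounded by \<open>V\<close>; the rescaling costs the factor
      \<open>V powr U\<close>.\<close>
    define t where "t = F x / V"
    have t: "0 \<le> t" "t \<le> 1" "F x = V * t" "t \<le> F x"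
      using F[of x] V by (auto simp: t_def field_simps)
        (use V F[of x] mult_left_mono[of 1 V "F x"] in \<open>simp add: mult.commute\<close>)
    have "F x powr P x = V powr P x * t powr P x"
      using t V by (simp add: powr_mult)
    also have "\<dots> \<le> V powr U * (exp (N * K) * t powr Pinf + ?h x)"
      using t V P e1 decay[of x] N
      by (intro mult_mono powr_mono powr_exponent_change) auto
    also have "\<dots> \<le> V powr U * (exp (N * K) * F x powr Pinf + ?h x)"
      using t Pinf by (intro mult_left_mono add_right_mono powr_mono2) auto
    finally have "ennreal (F x powr P x) \<le> ennreal (V powr U * (exp (N * K) * F x powr Pinf + ?h x))"
      by (rule ennreal_leI)
    also have "\<dots> = ennreal (V powr U) * (ennreal (exp (N * K)) * ennreal (F x powr Pinf) + ennreal (?h x))"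
      by (simp add: ennreal_mult)
    finally show "ennreal (F x powr P x) \<le> \<dots>" .
  qed
  also have "\<dots> = ennreal (V powr U) * (ennreal (exp (N * K)) * (\<integral>\<^sup>+x. ennreal (F x powr Pinf) \<partial>lborel) + J)"
    unfolding J_def by (simp add: nn_integral_cmult nn_integral_add)
  also have "\<dots> \<le> ennreal (V powr U) * (ennreal (exp (N * K)) * (ennreal (strong_constant TYPE('a) Pinf) * (\<integral>\<^sup>+y. ennreal (g y powr Pinf) \<partial>lborel)) + J)"
    unfolding F_def using Pinf g by (intro mult_left_mono add_right_mono maximal_strong_type) auto
  also have "\<dots> \<le> ennreal (V powr U) * (ennreal (exp (N * K)) * (ennreal (strong_constant TYPE('a) Pinf) * (ennreal (exp (N * K)) + J)) + J)"
  proof (intro mult_left_mono add_right_mono)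
    have "(\<integral>\<^sup>+y. ennreal (g y powr Pinf) \<partial>lborel)
      \<le> (\<integral>\<^sup>+y. ennreal (exp (N * K)) * ennreal (g y powr P y) + ennreal (?h y) \<partial>lborel)"
    proof (rule nn_integral_mono)
      fix y
      have "g y powr Pinf \<le> exp (N * K) * g y powr P y + ?h y"
        using g Pinf e1 decay[of y] N by (intro powr_exponent_change) (auto simp: abs_minus_commute)
      then show "ennreal (g y powr Pinf) \<le> ennreal (exp (N * K)) * ennreal (g y powr P y) + ennreal (?h y)"
        by (simp add: ennreal_mult[symmetric] ennreal_plus[symmetric] del: ennreal_plus)
    qed
    also have "\<dots> = ennreal (exp (N * K)) * (\<integral>\<^sup>+y. ennreal (g y powr P y) \<partial>lborel) + J"
      unfolding J_def by (simp add: nn_integral_cmult nn_integral_add)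
    also have "\<dots> \<le> ennreal (exp (N * K)) * 1 + J"
      by (intro add_right_mono mult_left_mono mod) auto
    finally show "(\<integral>\<^sup>+y. ennreal (g y powr Pinf) \<partial>lborel) \<le> ennreal (exp (N * K)) + J" by simp
  qed auto
  finally show "(\<integral>\<^sup>+x. ennreal (enn2real (?M x) powr P x) \<partial>lborel)
    \<le> ennreal (V powr U) * (ennreal (exp (N * K)) * (ennreal (strong_constant TYPE('a) Pinf) * (ennreal (exp (N * K)) + J)) + J)"
    unfolding F_def .
qed

text \<open>
  Since a nonzero value of \<open>g\<close> is at least \<open>1\<close> and the modular is at most \<open>1\<close>, the mean of
  \<open>g powr u\<close> over a ball of radius \<open>r\<close> is at most \<open>r powr - d\<close>; local log-Hoelder continuity bounds
  the resulting powers of \<open>r\<close> whose exponent is an oscillation of \<open>u\<close>.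
\<close>

lemma ball_integral_powr_exponent:
  fixes g u :: "'a::euclidean_space \<Rightarrow> real" and K :: real
  assumes [measurable]: "g \<in> borel_measurable borel" "u \<in> borel_measurable borel"
    and u: "\<And>x. 1 \<le> u x"
    and hold: "\<And>x y. \<bar>u x - u y\<bar> * ln (exp 1 + 1 / norm (x - y)) \<le> K"
    and g: "\<And>y. g y = 0 \<or> 1 \<le> g y"
    and mod: "(\<integral>\<^sup>+y. ennreal (g y powr u y) \<partial>lborel) \<le> 1"
    and r: "r > 0"
    and A: "(\<integral>\<^sup>+y\<in>ball x r. ennreal (g y powr u y) \<partial>lborel) = ennreal (A * r ^ DIM('a))" "A \<ge> 0"
  shows "(\<integral>\<^sup>+y\<in>ball x r. ennreal (g y) \<partial>lborel)
    \<le> ennreal ((unit_ball_vol (real DIM('a)) + exp (DIM('a) * K)) * A powr (1 / u x) * r ^ DIM('a))"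
proof -
  let ?d = "DIM('a)"
  define W where "W = unit_ball_vol (real ?d)"
  define D where "D = W + exp (?d * K)"
  have K: "K \<ge> 0" using hold[of x x] by simp
  have W: "W > 0" unfolding W_def by simp
  have "exp (?d * K) \<ge> 1" using K by simp
  then have D: "D \<ge> 1" unfolding D_def using W by linarith
  have g0: "g y \<ge> 0" for y using g[of y] by linarith
  have gu: "g y \<le> g y powr u y" for y
    using g[of y] u[of y] powr_mono[of 1 "u y" "g y"] by auto
  have bm [measurable]: "ball x r \<in> sets borel" by simp
  have "(\<integral>\<^sup>+y\<in>ball x r. ennreal (g y) \<partial>lborel) \<le> ennreal (D * A powr (1 / u x) * r ^ ?d)"
  proof (cases "A \<le> 1")
    \<comment> \<open>No oscillation estimate is needed here: \<open>g\<close> is at most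
      \<open>g powr u\<close>, so its normalised mean is at most \<open>A\<close>, which is at most
      \<open>A powr (1 / u x)\<close> because \<open>A\<close> is at most 1.\<close>
    case True
    have "(\<integral>\<^sup>+y\<in>ball x r. ennreal (g y) \<partial>lborel) \<le> (\<integral>\<^sup>+y\<in>ball x r. ennreal (g y powr u y) \<partial>lborel)"
      by (intro nn_integral_mono mult_right_mono ennreal_leI gu) auto
    also have "\<dots> = ennreal (A * r ^ ?d)" by (rule A)
    also have "A powr 1 \<le> A powr (1 / u x)"
      using True A u[of x] by (intro powr_mono') auto
    then have "A \<le> D * A powr (1 / u x)"
      using D A mult_mono[of 1 D A "A powr (1 / u x)"] by simp
    then have "ennreal (A * r ^ ?d) \<le> ennreal (D * A powr (1 / u x) * r ^ ?d)"
      using r by (intro ennreal_leI mult_right_mono) auto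
    finally show ?thesis .
  next
    case False
    then have A1: "A > 1" by simp
    have "ennreal (A * r ^ ?d) \<le> (\<integral>\<^sup>+y. ennreal (g y powr u y) \<partial>lborel)"
      unfolding A(1)[symmetric] by (intro nn_integral_mono) (auto simp: indicator_def)
    also note mod
    finally have Ard: "A * r ^ ?d \<le> 1"
      using ennreal_le_iff[of 1 "A * r ^ ?d"] by simp
    \<comment> \<open>Up to the factor \<open>D\<close>, \<open>k\<close> is the claimed bound for
      the normalised mean of \<open>g\<close>. Values up to \<open>k\<close> are kept as they are; a
      larger value \<open>g y\<close> is traded for \<open>g y powr u y\<close> at the price
      \<open>k powr (1 - u y)\<close>.\<close>
    define k where "k = A powr (1 / u x)"
    have k: "k \<ge> 1" unfolding k_def using A1 u[of x] by (intro ge_one_powr_ge_zero) auto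
    define E where "E = exp (?d * K)"
    have osc: "A powr ((u x - u y) / u x) \<le> E" if y: "y \<in> ball x r" for y
    \<comment> \<open>At the centre the convention \<open>1 / 0 = 0\<close> breaks the comparison of
      \<open>1 / r\<close> with \<open>1 / norm (x - y)\<close>, but there the exponent is
      0.\<close>
    proof (cases "y = x")
      case True then show ?thesis using A1 K by (simp add: E_def)
    next
      case yx: False
      have n: "norm (x - y) < r" "norm (x - y) > 0" using y yx by (auto simp: dist_norm)
      have "ln A \<le> ?d * ln (1 / r)"
      proof -
        have "A \<le> (1 / r) ^ ?d" using Ard r by (simp add: field_simps)
        then have "ln A \<le> ln ((1 / r) ^ ?d)" using A1 r by (subst ln_le_cancel_iff) auto
        then show ?thesis using r by (simp add: ln_realpow)
      qed
      also have "\<dots> \<le> ?d * ln (exp 1 + 1 / norm (x - y))"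
      proof -
        have "1 / r \<le> 1 / norm (x - y)" using n r by (intro divide_left_mono mult_pos_pos) auto
        then have "1 / r \<le> exp 1 + 1 / norm (x - y)" by (simp add: add_increasing)
        moreover have "0 < exp 1 + 1 / norm (x - y)" using n by (intro add_pos_pos) auto
        ultimately show ?thesis using r by (intro mult_left_mono) (auto simp: ln_le_cancel_iff)
      qed
      finally have lnA: "ln A \<le> ?d * ln (exp 1 + 1 / norm (x - y))" .
      have "(u x - u y) / u x \<le> \<bar>u x - u y\<bar> / 1"
        using u[of x] by (intro frac_le) auto
      then have "(u x - u y) / u x * ln A \<le> \<bar>u x - u y\<bar> * ln A"
        using A1 by (intro mult_right_mono) auto
      also have "\<dots> \<le> \<bar>u x - u y\<bar> * (?d * ln (exp 1 + 1 / norm (x - y)))"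
        using lnA by (intro mult_left_mono) auto
      also have "\<dots> \<le> ?d * K"
        using mult_left_mono[OF hold[of x y], of "real ?d"] by (simp add: mult_ac)
      finally show ?thesis using A1 by (simp add: powr_def E_def)
    qed
    have pt: "g y \<le> k + A powr (1 / u x - 1) * E * g y powr u y" if y: "y \<in> ball x r" for y
    proof (cases "g y \<le> k")
      case True
      then show ?thesis by (simp add: add_increasing2 E_def)
    next
      case False
      have "g y = g y powr u y * g y powr (1 - u y)"
        using False k by (simp add: powr_add[symmetric])
      also have "\<dots> \<le> g y powr u y * k powr (1 - u y)"
        using False k u[of y] by (intro mult_left_mono powr_mono2') auto
      \<comment> \<open>The oscillation is split off; the other factor
        \<open>A powr (1 / u x - 1)\<close> will combine with the mean \<open>A\<close> of
        \<open>g powr u\<close> to give \<open>k\<close> again.\<close>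
      also have "k powr (1 - u y) = A powr (1 / u x - 1) * A powr ((u x - u y) / u x)"
        unfolding k_def powr_powr powr_add[symmetric] using u[of x] by (auto simp: field_simps intro!: arg_cong2[where f="(powr)"])
      also have "g y powr u y * (A powr (1 / u x - 1) * A powr ((u x - u y) / u x))
        \<le> g y powr u y * (A powr (1 / u x - 1) * E)"
        using osc[OF y] by (intro mult_left_mono) auto
      finally show ?thesis using k by (simp add: mult_ac)
    qed
    have "(\<integral>\<^sup>+y\<in>ball x r. ennreal (g y) \<partial>lborel)
      \<le> (\<integral>\<^sup>+y. ennreal k * indicator (ball x r) y
          + ennreal (A powr (1 / u x - 1) * E) * (ennreal (g y powr u y) * indicator (ball x r) y) \<partial>lborel)"
    proof (rule nn_integral_mono)
      fix y
      show "ennreal (g y) * indicator (ball x r) y \<le> ennreal k * indicator (ball x r) y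
          + ennreal (A powr (1 / u x - 1) * E) * (ennreal (g y powr u y) * indicator (ball x r) y)"
      proof (cases "y \<in> ball x r")
        case True
        have "ennreal (g y) \<le> ennreal (k + A powr (1 / u x - 1) * E * g y powr u y)"
          by (intro ennreal_leI pt True)
        also have "\<dots> = ennreal k + ennreal (A powr (1 / u x - 1) * E) * ennreal (g y powr u y)"
          using k by (subst ennreal_plus) (auto simp: E_def ennreal_mult)
        finally show ?thesis using True by simp
      qed simp
    qed
    also have "\<dots> = ennreal k * ennreal (W * r ^ ?d) + ennreal (A powr (1 / u x - 1) * E) * ennreal (A * r ^ ?d)"
      using r by (simp add: nn_integral_add nn_integral_cmult A nn_integral_cmult_indicator emeasure_lborel_ball W_def del: ennreal_mult_eq_top_iff)
    also have "\<dots> = ennreal (k * (W * r ^ ?d) + A powr (1 / u x - 1) * E * (A * r ^ ?d))"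
      using k W r A1 by (simp add: ennreal_mult E_def)
    also have "k * (W * r ^ ?d) + A powr (1 / u x - 1) * E * (A * r ^ ?d) = D * k * r ^ ?d"
    proof -
      have "A powr (1 / u x - 1) * A = k" unfolding k_def using A1 by (simp add: powr_diff)
      then have "A powr (1 / u x - 1) * E * (A * r ^ ?d) = k * E * r ^ ?d"
        by (metis mult.assoc mult.commute)
      then show ?thesis unfolding D_def E_def by (simp add: algebra_simps)
    qed
    finally show ?thesis unfolding k_def .
  qed
  then show ?thesis unfolding D_def W_def .
qed


text \<open>The Jensen-type estimate is used with \<open>u = P / m\<close>. Raising it to the power
  \<open>P x\<close> turns the exponent \<open>1 / u x\<close> into the constant \<open>m\<close>,
  and \<open>G powr m\<close> is again \<open>g powr P\<close>, so the strong-type bound in exponent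
  \<open>m\<close> ends at the given modular. Dividing by \<open>m\<close> also divides the
  oscillation, hence \<open>K / m\<close> in \<open>D\<close>.\<close>

lemma nn_integral_maximal_large_part:
  fixes g P :: "'a::euclidean_space \<Rightarrow> real"
  assumes [measurable]: "g \<in> borel_measurable borel" "P \<in> borel_measurable borel"
    and m: "1 < m" and P: "\<And>x. m \<le> P x" "\<And>x. P x \<le> U"
    and hold: "\<And>x y. \<bar>P x - P y\<bar> * ln (exp 1 + 1 / norm (x - y)) \<le> K"
    and g: "\<And>y. g y = 0 \<or> 1 \<le> g y"
    and mod: "(\<integral>\<^sup>+y. ennreal (g y powr P y) \<partial>lborel) \<le> 1"
  defines "D \<equiv> unit_ball_vol (real DIM('a)) + exp (real DIM('a) * (K / m))"
  shows "(\<integral>\<^sup>+x. ennreal (enn2real (maximal (\<lambda>y. ennreal (g y)) x) powr P x) \<partial>lborel)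
    \<le> ennreal (D powr U * strong_constant TYPE('a) m)"
    and "AE x in lborel. maximal (\<lambda>y. ennreal (g y)) x < \<infinity>"
proof -
  let ?d = "DIM('a)"
  let ?M = "maximal (\<lambda>y. ennreal (g y))"
  define u where "u x = P x / m" for x
  define G where "G y = g y powr u y" for y
  let ?MG = "maximal (\<lambda>y. ennreal (G y))"
  have um [measurable]: "u \<in> borel_measurable borel" unfolding u_def[abs_def] by measurable
  have Gm [measurable]: "G \<in> borel_measurable borel" unfolding G_def[abs_def] by measurable
  have u: "u x \<ge> 1" for x using P m by (simp add: u_def)
  have uP: "u x \<le> P x" for x
    unfolding u_def using m P(1)[of x] mult_left_mono[of 1 m "P x"] by (simp add: field_simps)
  have K: "K \<ge> 0" using hold[of 0 0] by simp
  have "exp (real ?d * (K / m)) \<ge> 1" using K m by simp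
  then have D: "D \<ge> 1" unfolding D_def using unit_ball_vol_nonneg[of "real ?d"] by linarith
  have hold': "\<bar>u x - u y\<bar> * ln (exp 1 + 1 / norm (x - y)) \<le> K / m" for x y
  proof -
    have "\<bar>u x - u y\<bar> = \<bar>P x - P y\<bar> / m"
      using m by (simp add: u_def diff_divide_distrib[symmetric])
    then show ?thesis using hold[of x y] m by (simp add: divide_right_mono)
  qed
  have g0: "g y \<ge> 0" for y using g[of y] by linarith
  have Gle: "G y \<le> g y powr P y" for y
    unfolding G_def using g[of y] uP[of y] powr_mono[of "u y" "P y" "g y"] by auto
  \<comment> \<open>Lowering the exponent from \<open>P\<close> to \<open>u\<close> does not
    increase the modular, since no value of \<open>g\<close> lies strictly between 0 and 1.\<close>
  have modG: "(\<integral>\<^sup>+y. ennreal (G y) \<partial>lborel) \<le> 1"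
    using mod by (rule order_trans[rotated]) (intro nn_integral_mono ennreal_leI Gle)
  have GP: "G y powr m = g y powr P y" for y
    unfolding G_def u_def powr_powr using m by simp
  have finG: "AE x in lborel. ?MG x < \<infinity>"
  proof (rule AE_maximal_finite[OF Gm _ m])
    show "0 \<le> G y" for y by (simp add: G_def)
    show "(\<integral>\<^sup>+y. ennreal (G y powr m) \<partial>lborel) < \<infinity>"
      unfolding GP using mod by (rule le_less_trans) simp
  qed
  have MM: "?M x \<le> ennreal (D * enn2real (?MG x) powr (1 / u x))" if fin: "?MG x < \<infinity>" for x
    unfolding maximal_le_iff
  proof
    fix k :: int
    define r :: real where "r = 2 powr k"
    have r: "r > 0" unfolding r_def by simp
    have "(\<integral>\<^sup>+y\<in>ball x r. ennreal (G y) \<partial>lborel) \<le> (\<integral>\<^sup>+y. ennreal (G y) \<partial>lborel)"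
      by (intro nn_integral_mono) (auto simp: indicator_def)
    also have "\<dots> < \<infinity>" using modG le_less_trans by fastforce
    finally obtain I where I: "(\<integral>\<^sup>+y\<in>ball x r. ennreal (G y) \<partial>lborel) = ennreal I" "I \<ge> 0"
      by (cases "\<integral>\<^sup>+y\<in>ball x r. ennreal (G y) \<partial>lborel") auto
    define A where "A = I / r ^ ?d"
    have A: "(\<integral>\<^sup>+y\<in>ball x r. ennreal (g y powr u y) \<partial>lborel) = ennreal (A * r ^ ?d)" "A \<ge> 0"
      using I r by (simp_all add: A_def G_def)
    have "(\<integral>\<^sup>+y\<in>ball x r. ennreal (G y) \<partial>lborel) \<le> ?MG x * ennreal (r ^ ?d)"
      using maximal_le_iff[of "\<lambda>y. ennreal (G y)" x "?MG x"] unfolding r_def by blast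
    then have "ennreal (A * r ^ ?d) \<le> ?MG x * ennreal (r ^ ?d)"
      using A(1) by (simp add: G_def)
    also have "\<dots> = ennreal (enn2real (?MG x) * r ^ ?d)"
      using fin r by (simp add: ennreal_mult)
    finally have "A * r ^ ?d \<le> enn2real (?MG x) * r ^ ?d"
      using r by (subst (asm) ennreal_le_iff) auto
    then have Ale: "A \<le> enn2real (?MG x)"
      using r by simp
    have "(\<integral>\<^sup>+y\<in>ball x r. ennreal (g y) \<partial>lborel) \<le> ennreal (D * A powr (1 / u x) * r ^ ?d)"
      unfolding D_def
      by (rule ball_integral_powr_exponent[where u = u, OF _ um u hold' g _ r A])
        (use modG in \<open>auto simp: G_def\<close>)
    also have "\<dots> \<le> ennreal (D * enn2real (?MG x) powr (1 / u x) * r ^ ?d)"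
      using Ale A D r u[of x] by (intro ennreal_leI mult_right_mono mult_left_mono powr_mono2) auto
    also have "\<dots> = ennreal (D * enn2real (?MG x) powr (1 / u x)) * ennreal (r ^ ?d)"
      using D r by (intro ennreal_mult) auto
    finally show "(\<integral>\<^sup>+y\<in>ball x (2 powr real_of_int k). ennreal (g y) \<partial>lborel)
      \<le> ennreal (D * enn2real (?MG x) powr (1 / u x)) * ennreal ((2 powr real_of_int k) ^ ?d)"
      unfolding r_def .
  qed
  show "AE x in lborel. ?M x < \<infinity>"
    using finG by eventually_elim (use MM le_less_trans in fastforce)
  have "(\<integral>\<^sup>+x. ennreal (enn2real (?M x) powr P x) \<partial>lborel)
    \<le> (\<integral>\<^sup>+x. ennreal (D powr U) * ennreal (enn2real (?MG x) powr m) \<partial>lborel)"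
  proof (rule nn_integral_mono_AE)
    show "AE x in lborel. ennreal (enn2real (?M x) powr P x)
      \<le> ennreal (D powr U) * ennreal (enn2real (?MG x) powr m)"
      using finG
    proof eventually_elim
      fix x assume fin: "?MG x < \<infinity>"
      have "enn2real (?M x) \<le> D * enn2real (?MG x) powr (1 / u x)"
        using MM[OF fin] D by (intro enn2real_leI) auto
      then have "enn2real (?M x) powr P x \<le> (D * enn2real (?MG x) powr (1 / u x)) powr P x"
        using P(1)[of x] m by (intro powr_mono2) auto
      also have "\<dots> = D powr P x * enn2real (?MG x) powr m"
        using D P(1)[of x] m by (simp add: powr_mult powr_powr u_def)
      also have "\<dots> \<le> D powr U * enn2real (?MG x) powr m"
        using D P by (intro mult_right_mono powr_mono) auto
      finally show "ennreal (enn2real (?M x) powr P x) \<le> ennreal (D powr U) * ennreal (enn2real (?MG x) powr m)"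
        by (simp add: ennreal_mult[symmetric] ennreal_leI)
    qed
  qed
  also have "\<dots> = ennreal (D powr U) * (\<integral>\<^sup>+x. ennreal (enn2real (?MG x) powr m) \<partial>lborel)"
    by (simp add: nn_integral_cmult)
  also have "\<dots> \<le> ennreal (D powr U) * (ennreal (strong_constant TYPE('a) m) * (\<integral>\<^sup>+y. ennreal (G y powr m) \<partial>lborel))"
    using m by (intro mult_left_mono maximal_strong_type) (auto simp: G_def)
  also have "\<dots> \<le> ennreal (D powr U) * (ennreal (strong_constant TYPE('a) m) * 1)"
    unfolding GP by (intro mult_left_mono mod) auto
  also have "\<dots> = ennreal (D powr U * strong_constant TYPE('a) m)"
    using strong_constant_pos[OF m, where 'a='a] by (simp add: ennreal_mult)
  finally show "(\<integral>\<^sup>+x. ennreal (enn2real (?M x) powr P x) \<partial>lborel)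
    \<le> ennreal (D powr U * strong_constant TYPE('a) m)" .
qed

text \<open>The finiteness claim is not contained in the modular bound, because
  \<open>enn2real\<close> hides infinite values. The bound \<open>C\<close> may exceed 1; it is
  normalised later by a division.\<close>

theorem maximal_variable_exponent:
  fixes P :: "'a::euclidean_space \<Rightarrow> real"
  assumes Pm [measurable]: "P \<in> borel_measurable borel"
    and m: "1 < m" and P: "\<And>x. m \<le> P x" "\<And>x. P x \<le> U" and Pinf: "1 < Pinf"
    and hold: "\<And>x y. \<bar>P x - P y\<bar> * ln (exp 1 + 1 / norm (x - y)) \<le> K"
    and decay: "\<And>x. \<bar>P x - Pinf\<bar> * ln (exp 1 + norm x) \<le> K"
  obtains C where "C > 0"
    "\<And>g. g \<in> borel_measurable borel \<Longrightarrow> (\<And>y. 0 \<le> g y) \<Longrightarrow> (\<integral>\<^sup>+y. ennreal (g y powr P y) \<partial>lborel) \<le> 1 \<Longrightarrow>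
      AE x in lborel. maximal (\<lambda>y. ennreal (g y)) x < \<infinity>"
    "\<And>g. g \<in> borel_measurable borel \<Longrightarrow> (\<And>y. 0 \<le> g y) \<Longrightarrow> (\<integral>\<^sup>+y. ennreal (g y powr P y) \<partial>lborel) \<le> 1 \<Longrightarrow>
      (\<integral>\<^sup>+x. ennreal (enn2real (maximal (\<lambda>y. ennreal (g y)) x) powr P x) \<partial>lborel) \<le> ennreal C"
proof -
  define N where "N = real DIM('a) + 1"
  define J where "J = (\<integral>\<^sup>+x. ennreal ((exp 1 + norm (x::'a)) powr - N) \<partial>lborel)"
  have J: "J < \<infinity>" unfolding J_def N_def by (rule nn_integral_decay_finite)
  define V where "V = max 1 (unit_ball_vol (real DIM('a)))"
  define D where "D = unit_ball_vol (real DIM('a)) + exp (real DIM('a) * (K / m))"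
  define C1 where "C1 = ennreal (D powr U * strong_constant TYPE('a) m)"
  define C2 where "C2 = ennreal (V powr U) * (ennreal (exp (N * K)) * (ennreal (strong_constant TYPE('a) Pinf) * (ennreal (exp (N * K)) + J)) + J)"
  have "C2 < \<infinity>" unfolding C2_def using J by (auto simp: ennreal_mult_less_top less_top[symmetric] ennreal_mult_eq_top_iff)
  then have Cfin: "ennreal (2 powr U) * (C1 + C2) < \<infinity>"
    unfolding C1_def by (auto simp: ennreal_mult_less_top)
  define C where "C = enn2real (ennreal (2 powr U) * (C1 + C2)) + 1"
  have C: "ennreal (2 powr U) * (C1 + C2) \<le> ennreal C"
    using Cfin unfolding C_def by (cases "ennreal (2 powr U) * (C1 + C2)") (auto simp: ennreal_leI)
  have main: "(AE x in lborel. maximal (\<lambda>y. ennreal (g y)) x < \<infinity>) \<and>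
      (\<integral>\<^sup>+x. ennreal (enn2real (maximal (\<lambda>y. ennreal (g y)) x) powr P x) \<partial>lborel) \<le> ennreal C"
    if gm [measurable]: "g \<in> borel_measurable borel" and g0: "\<And>y. 0 \<le> g y"
      and mod: "(\<integral>\<^sup>+y. ennreal (g y powr P y) \<partial>lborel) \<le> 1" for g
  proof -
    define g1 where "g1 y = (if 1 \<le> g y then g y else 0)" for y
    define g2 where "g2 y = (if 1 \<le> g y then 0 else g y)" for y
    have [measurable]: "g1 \<in> borel_measurable borel" "g2 \<in> borel_measurable borel"
      unfolding g1_def[abs_def] g2_def[abs_def] by measurable
    let ?M = "maximal (\<lambda>y. ennreal (g y))"
    let ?M1 = "maximal (\<lambda>y. ennreal (g1 y))"
    let ?M2 = "maximal (\<lambda>y. ennreal (g2 y))"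
    have P1: "1 \<le> P x" for x using P(1)[of x] m by simp
    have mod1: "(\<integral>\<^sup>+y. ennreal (g1 y powr P y) \<partial>lborel) \<le> 1"
      using mod by (rule order_trans[rotated]) (intro nn_integral_mono ennreal_leI, auto simp: g1_def)
    have mod2: "(\<integral>\<^sup>+y. ennreal (g2 y powr P y) \<partial>lborel) \<le> 1"
      using mod by (rule order_trans[rotated]) (intro nn_integral_mono ennreal_leI, auto simp: g2_def)
    have I1: "(\<integral>\<^sup>+x. ennreal (enn2real (?M1 x) powr P x) \<partial>lborel) \<le> C1" "AE x in lborel. ?M1 x < \<infinity>"
      unfolding C1_def D_def
      by (rule nn_integral_maximal_large_part[OF _ Pm m P hold _ mod1]; force simp: g1_def)+
    have I2: "(\<integral>\<^sup>+x. ennreal (enn2real (?M2 x) powr P x) \<partial>lborel) \<le> C2" "\<And>x. ?M2 x < \<infinity>"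
      unfolding C2_def V_def J_def N_def
      by (rule nn_integral_maximal_bounded_part[OF _ Pm P1 P(2) Pinf decay _ _ mod2]; force simp: g2_def g0)+
    have split: "?M x \<le> ?M1 x + ?M2 x" for x
    proof -
      have "(\<lambda>y. ennreal (g y)) = (\<lambda>y. ennreal (g1 y) + ennreal (g2 y))"
        by (auto simp: g1_def g2_def)
      then show ?thesis by (simp add: maximal_add)
    qed
    have "AE x in lborel. ?M x < \<infinity>"
      using I1(2)
    proof eventually_elim
      fix x assume "?M1 x < \<infinity>"
      then have "?M1 x + ?M2 x < \<infinity>" using I2(2)[of x] by simp
      then show "?M x < \<infinity>" using split[of x] by (rule le_less_trans[rotated])
    qed
    moreover have "(\<integral>\<^sup>+x. ennreal (enn2real (?M x) powr P x) \<partial>lborel) \<le> ennreal C"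
    proof -
      have "(\<integral>\<^sup>+x. ennreal (enn2real (?M x) powr P x) \<partial>lborel)
        \<le> (\<integral>\<^sup>+x. ennreal (2 powr U) * (ennreal (enn2real (?M1 x) powr P x) + ennreal (enn2real (?M2 x) powr P x)) \<partial>lborel)"
      proof (rule nn_integral_mono_AE)
        show "AE x in lborel. ennreal (enn2real (?M x) powr P x)
          \<le> ennreal (2 powr U) * (ennreal (enn2real (?M1 x) powr P x) + ennreal (enn2real (?M2 x) powr P x))"
          using I1(2)
        proof eventually_elim
          fix x assume f1: "?M1 x < \<infinity>"
          define a where "a = enn2real (?M1 x)"
          define b where "b = enn2real (?M2 x)"
          have ab: "a \<ge> 0" "b \<ge> 0" unfolding a_def b_def by auto
          have "?M1 x = ennreal a" "?M2 x = ennreal b"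
            unfolding a_def b_def using f1 I2(2)[of x] by auto
          then have "?M x \<le> ennreal (a + b)" using split[of x] ab by simp
          then have "enn2real (?M x) \<le> a + b" using ab by (intro enn2real_leI) auto
          \<comment> \<open>Passing through the maximum bounds the power of the sum by
            \<open>2 powr U\<close> times the sum of the powers, uniformly in the exponent.\<close>
          also have "\<dots> \<le> 2 * max a b" by simp
          finally have "enn2real (?M x) powr P x \<le> (2 * max a b) powr P x"
            using P1[of x] by (intro powr_mono2) auto
          also have "\<dots> = 2 powr P x * max a b powr P x"
            using ab by (intro powr_mult)
          also have "\<dots> \<le> 2 powr U * (a powr P x + b powr P x)"
            using P ab by (intro mult_mono powr_mono) (auto simp: max_def)
          finally have "ennreal (enn2real (?M x) powr P x) \<le> ennreal (2 powr U * (a powr P x + b powr P x))"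
            by (rule ennreal_leI)
          then show "ennreal (enn2real (?M x) powr P x)
            \<le> ennreal (2 powr U) * (ennreal (enn2real (?M1 x) powr P x) + ennreal (enn2real (?M2 x) powr P x))"
            unfolding a_def b_def by (simp add: ennreal_mult)
        qed
      qed
      also have "\<dots> = ennreal (2 powr U) * ((\<integral>\<^sup>+x. ennreal (enn2real (?M1 x) powr P x) \<partial>lborel)
          + (\<integral>\<^sup>+x. ennreal (enn2real (?M2 x) powr P x) \<partial>lborel))"
        by (simp add: nn_integral_cmult nn_integral_add)
      also have "\<dots> \<le> ennreal (2 powr U) * (C1 + C2)"
        by (intro mult_left_mono add_mono I1 I2) auto
      also note C
      finally show ?thesis .
    qed
    ultimately show ?thesis by blast
  qed
  have "C > 0" unfolding C_def by (simp add: add_nonneg_pos)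
  then show thesis using main by (intro that) auto
qed

section \<open>Hedberg's inequality\<close>

text \<open>Hoelder's inequality with a cruder constant, obtained from
  \<open>g \<le> t + t powr (1 - q) * g powr q\<close>. The choice
  \<open>t = r powr (- d / q)\<close> gives both terms the size \<open>r powr (d - d / q)\<close>,
  which explains the constant: the volume of the unit ball plus 1.\<close>

lemma ball_integral_le_Lebesgue:
  fixes g :: "'a::euclidean_space \<Rightarrow> real" and q :: real
  assumes [measurable]: "g \<in> borel_measurable borel" and g: "\<And>y. 0 \<le> g y"
    and q: "1 < q" and int: "(\<integral>\<^sup>+y. ennreal (g y powr q) \<partial>lborel) \<le> 1" and r: "0 < r"
  shows "(\<integral>\<^sup>+y\<in>ball x r. ennreal (g y) \<partial>lborel)
    \<le> ennreal ((unit_ball_vol (real DIM('a)) + 1) * r powr (DIM('a) - DIM('a) / q))"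
proof -
  let ?d = "DIM('a)"
  define W where "W = unit_ball_vol (real ?d)"
  have W: "W > 0" unfolding W_def by simp
  define t where "t = r powr (- (?d / q))"
  have t: "t > 0" unfolding t_def using r by simp
  have pt: "g y \<le> t + t powr (1 - q) * g y powr q" for y
  proof (cases "g y \<le> t")
    case False
    have "g y = g y powr (1 - q) * g y powr q"
      using False t by (simp add: powr_add[symmetric])
    also have "\<dots> \<le> t powr (1 - q) * g y powr q"
      using False t q by (intro mult_right_mono powr_mono2') auto
    finally show ?thesis using t by linarith
  qed (simp add: add_increasing2)
  have bm [measurable]: "ball x r \<in> sets borel" by simp
  have "(\<integral>\<^sup>+y\<in>ball x r. ennreal (g y) \<partial>lborel)
    \<le> (\<integral>\<^sup>+y. ennreal t * indicator (ball x r) y + ennreal (t powr (1 - q)) * ennreal (g y powr q) \<partial>lborel)"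
  proof (rule nn_integral_mono)
    fix y
    have "ennreal (g y) \<le> ennreal t + ennreal (t powr (1 - q)) * ennreal (g y powr q)"
      using t ennreal_leI[OF pt[of y]] by (simp add: ennreal_mult)
    then show "ennreal (g y) * indicator (ball x r) y
      \<le> ennreal t * indicator (ball x r) y + ennreal (t powr (1 - q)) * ennreal (g y powr q)"
      by (auto simp: indicator_def)
  qed
  also have "\<dots> = ennreal t * ennreal (W * r ^ ?d) + ennreal (t powr (1 - q)) * (\<integral>\<^sup>+y. ennreal (g y powr q) \<partial>lborel)"
    using r by (simp add: nn_integral_add nn_integral_cmult nn_integral_cmult_indicator emeasure_lborel_ball W_def)
  also have "\<dots> \<le> ennreal t * ennreal (W * r ^ ?d) + ennreal (t powr (1 - q)) * 1"
    by (intro add_left_mono mult_left_mono int) auto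
  also have "\<dots> = ennreal (t * (W * r ^ ?d) + t powr (1 - q))"
    using t W r by (simp add: ennreal_mult)
  also have "t * (W * r ^ ?d) + t powr (1 - q) = (W + 1) * r powr (?d - ?d / q)"
  proof -
    have "t * r ^ ?d = r powr (?d - ?d / q)"
      unfolding t_def using r by (simp add: powr_realpow[symmetric] powr_add[symmetric])
    moreover have "t powr (1 - q) = r powr (?d - ?d / q)"
    proof -
      have "- (?d / q) * (1 - q) = ?d - ?d / q" using q by (simp add: field_simps)
      then show ?thesis unfolding t_def powr_powr by simp
    qed
    ultimately show ?thesis by (simp add: algebra_simps)
  qed
  finally show ?thesis unfolding W_def .
qed

text \<open>The sums of two geometric series over dyadic annuli: ratio \<open>2 powr - s\<close>
  inside the splitting radius, which needs \<open>s > 0\<close>, and ratio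
  \<open>2 powr (s - d / q)\<close> outside, which needs \<open>s < d / q\<close>.\<close>

definition hedberg_constant :: "'a::euclidean_space itself \<Rightarrow> real \<Rightarrow> real \<Rightarrow> real \<Rightarrow> real"
  where "hedberg_constant _ q s c =
    2 powr (2 * real DIM('a) - s) / (1 - 2 powr - s)
    + c * 2 powr (DIM('a) - DIM('a) / q) / (1 - 2 powr (s - DIM('a) / q))"

lemma hedberg_constant_pos:
  assumes "0 < s" "s < DIM('a::euclidean_space) / q" "0 \<le> c"
  shows "hedberg_constant TYPE('a) q s c > 0"
proof -
  have "2 powr - s < (1::real)" "2 powr (s - DIM('a) / q) < (1::real)"
    using assms powr_less_mono[of "- s" 0 2] powr_less_mono[of "s - DIM('a) / q" 0 2] by simp_all
  then show ?thesis
    unfolding hedberg_constant_def using assms by (intro add_pos_nonneg divide_pos_pos divide_nonneg_nonneg) auto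
qed

text \<open>
  The radius \<open>A powr (- q / d)\<close>, that is \<open>2 powr \<rho>\<close>, separating the two families of dyadic annuli is
  the one at which the bounds for the mass of a ball that \<open>A\<close> and \<open>c\<close> provide are of the same size.
\<close>

lemma hedberg:
  fixes g :: "'a::euclidean_space \<Rightarrow> real" and q s c :: real
  assumes gm [measurable]: "g \<in> borel_measurable borel" and g: "\<And>y. 0 \<le> g y"
    and q: "1 < q" and s: "0 < s" "s < DIM('a) / q" and A: "0 < A" and c: "0 \<le> c"
    and near: "\<And>r. 0 < r \<Longrightarrow> (\<integral>\<^sup>+y\<in>ball x r. ennreal (g y) \<partial>lborel) \<le> ennreal (A * r ^ DIM('a))"
    and far: "\<And>r. 0 < r \<Longrightarrow> (\<integral>\<^sup>+y\<in>ball x r. ennreal (g y) \<partial>lborel) \<le> ennreal (c * r powr (DIM('a) - DIM('a) / q))"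
  shows "(\<integral>\<^sup>+y. ennreal (g y / norm (x - y) powr (DIM('a) - s)) \<partial>lborel)
    \<le> ennreal (hedberg_constant TYPE('a) q s c * A powr (1 - s * q / DIM('a)))"
proof -
  let ?d = "real DIM('a)"
  define a where "a = log 2 A"
  have Aa: "A = 2 powr a" unfolding a_def using A by simp
  define \<rho> where "\<rho> = - (q / ?d) * a"
  \<comment> \<open>Each term bounds the kernel on an annulus by its value at the inner radius and
    extends the integral to the whole outer ball, whose mass is controlled by \<open>near\<close> or
    \<open>far\<close>.\<close>
  define n where "n i y = ennreal (2 powr ((\<rho> - real i - 1) * (s - ?d)))
    * (ennreal (g y) * indicator (ball x (2 powr (\<rho> - real i + 1))) y)" for i :: nat and y
  define f where "f i y = ennreal (2 powr ((\<rho> + real i) * (s - ?d)))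
    * (ennreal (g y) * indicator (ball x (2 powr (\<rho> + real i + 1))) y)" for i :: nat and y
  have bm [measurable]: "ball x r \<in> sets borel" for r by simp
  have nm [measurable]: "n i \<in> borel_measurable borel" for i unfolding n_def[abs_def] by measurable
  have fm [measurable]: "f i \<in> borel_measurable borel" for i unfolding f_def[abs_def] by measurable
  have d: "?d > 0" by simp
  have sd: "s < ?d"
  proof -
    have "?d / q \<le> ?d / 1" using q d by (intro divide_left_mono) auto
    then show ?thesis using s by simp
  qed
  have pt: "ennreal (g y / norm (x - y) powr (?d - s)) \<le> (\<Sum>i. n i y) + (\<Sum>i. f i y)" for y
  proof (cases "y = x")
    case False
    define z where "z = norm (x - y)"
    have z: "z > 0" unfolding z_def using False by simp
    have kern: "g y / z powr (?d - s) \<le> 2 powr (e * (s - ?d)) * g y" if "2 powr e \<le> z" for e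
    proof -
      have "g y / z powr (?d - s) = z powr (s - ?d) * g y"
        using powr_minus_divide[of z "?d - s"] by simp
      also have "\<dots> \<le> (2 powr e) powr (s - ?d) * g y"
        using that sd g by (intro mult_right_mono powr_mono2') auto
      finally show ?thesis by (simp add: powr_powr)
    qed
    show ?thesis
    proof (cases "2 powr \<rho> \<le> z")
      case True
      then have "1 \<le> z / 2 powr \<rho>" by simp
      then obtain i where i: "2 ^ i \<le> z / 2 powr \<rho>" "z / 2 powr \<rho> < 2 ^ Suc i"
        using dyadic_bracket by blast
      have i': "2 powr (\<rho> + real i) \<le> z" "z < 2 powr (\<rho> + real i + 1)"
        using i by (simp_all add: powr_add powr_realpow field_simps)
      have "ennreal (g y / z powr (?d - s)) \<le> f i y"
        unfolding f_def using i'(2) kern[OF i'(1)]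
        by (simp add: dist_norm z_def[symmetric] ennreal_mult[symmetric] g ennreal_leI)
      also have "\<dots> \<le> (\<Sum>i. f i y)" by (rule le_suminf_ennreal)
      finally show ?thesis unfolding z_def by (simp add: add_increasing)
    next
      case False
      then have "1 \<le> 2 powr \<rho> / z" using z by simp
      then obtain i where i: "2 ^ i \<le> 2 powr \<rho> / z" "2 powr \<rho> / z < 2 ^ Suc i"
        using dyadic_bracket by blast
      \<comment> \<open>The bracket only gives \<open>z \<le> 2 powr (\<rho> - real i)\<close>,
        which does not fit an open ball of that radius; doubling the outer radius makes the
        inequality strict.\<close>
      have i': "2 powr (\<rho> - real i - 1) \<le> z" "z < 2 powr (\<rho> - real i + 1)"
      proof -
        have "2 powr (\<rho> - real i - 1) = 2 powr \<rho> / 2 ^ Suc i"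
          by (simp add: powr_diff powr_realpow)
        moreover have "2 powr \<rho> / 2 ^ Suc i \<le> z"
          using i z by (simp add: field_simps)
        ultimately show "2 powr (\<rho> - real i - 1) \<le> z" by simp
        have "z * 2 ^ i \<le> 2 powr \<rho>" using i z by (simp add: field_simps)
        also have "\<dots> < 2 * 2 powr \<rho>" by simp
        finally show "z < 2 powr (\<rho> - real i + 1)"
          by (simp add: powr_diff powr_add powr_realpow field_simps)
      qed
      have "ennreal (g y / z powr (?d - s)) \<le> n i y"
        unfolding n_def using i'(2) kern[OF i'(1)]
        by (simp add: dist_norm z_def[symmetric] ennreal_mult[symmetric] g ennreal_leI)
      also have "\<dots> \<le> (\<Sum>i. n i y)" by (rule le_suminf_ennreal)
      finally show ?thesis unfolding z_def by (simp add: add_increasing2)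
    qed
  qed simp
  have lt1: "2 powr - s < (1::real)" "2 powr (s - ?d / q) < (1::real)"
    using s powr_less_mono[of "- s" 0 2] powr_less_mono[of "s - DIM('a) / q" 0 2] by simp_all
  have th: "A powr (1 - s * q / ?d) = 2 powr (a * (1 - s * q / ?d))"
    by (simp add: Aa powr_powr)
  have "(\<integral>\<^sup>+y. ennreal (g y / norm (x - y) powr (?d - s)) \<partial>lborel)
    \<le> (\<integral>\<^sup>+y. (\<Sum>i. n i y) + (\<Sum>i. f i y) \<partial>lborel)"
    by (intro nn_integral_mono pt)
  also have "\<dots> = (\<Sum>i. \<integral>\<^sup>+y. n i y \<partial>lborel) + (\<Sum>i. \<integral>\<^sup>+y. f i y \<partial>lborel)"
    by (simp add: nn_integral_add nn_integral_suminf)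
  also have "\<dots> \<le> (\<Sum>i. ennreal ((A powr (1 - s * q / ?d) * 2 powr (2 * ?d - s)) * (2 powr - s) ^ i))
    + (\<Sum>i. ennreal ((A powr (1 - s * q / ?d) * (c * 2 powr (?d - ?d / q))) * (2 powr (s - ?d / q)) ^ i))"
  proof (intro add_mono suminf_le allI summableI)
    fix i
    have "(\<integral>\<^sup>+y. n i y \<partial>lborel) \<le> ennreal (2 powr ((\<rho> - real i - 1) * (s - ?d)))
      * ennreal (A * (2 powr (\<rho> - real i + 1)) ^ DIM('a))"
      unfolding n_def by (subst nn_integral_cmult) (auto intro!: mult_left_mono near)
    also have "\<dots> = ennreal (2 powr ((\<rho> - real i - 1) * (s - ?d)) * (2 powr a * 2 powr ((\<rho> - real i + 1) * ?d)))"
      unfolding Aa by (subst ennreal_mult) (auto simp: powr_realpow[symmetric] powr_powr)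
    also have "2 powr ((\<rho> - real i - 1) * (s - ?d)) * (2 powr a * 2 powr ((\<rho> - real i + 1) * ?d))
      = (A powr (1 - s * q / ?d) * 2 powr (2 * ?d - s)) * (2 powr - s) ^ i"
    proof -
      \<comment> \<open>Here \<open>\<rho> * s + a\<close>, and in the far series
        \<open>\<rho> * (s - d / q)\<close>, both equal \<open>a * (1 - s * q / d)\<close>. This
        coincidence is what the choice of \<open>\<rho>\<close> achieves.\<close>
      have "(\<rho> - real i - 1) * (s - ?d) + (a + (\<rho> - real i + 1) * ?d)
        = a * (1 - s * q / ?d) + (2 * ?d - s) + (- s) * real i"
        unfolding \<rho>_def using d by (simp add: field_simps)
      then show ?thesis
        unfolding th by (simp add: powr_realpow[symmetric] powr_powr powr_add[symmetric] add.assoc)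
    qed
    finally show "(\<integral>\<^sup>+y. n i y \<partial>lborel)
      \<le> ennreal ((A powr (1 - s * q / ?d) * 2 powr (2 * ?d - s)) * (2 powr - s) ^ i)" .
    have "(\<integral>\<^sup>+y. f i y \<partial>lborel) \<le> ennreal (2 powr ((\<rho> + real i) * (s - ?d)))
      * ennreal (c * (2 powr (\<rho> + real i + 1)) powr (?d - ?d / q))"
      unfolding f_def by (subst nn_integral_cmult) (auto intro!: mult_left_mono far)
    also have "\<dots> = ennreal (c * (2 powr ((\<rho> + real i) * (s - ?d)) * 2 powr ((\<rho> + real i + 1) * (?d - ?d / q))))"
      using c by (subst ennreal_mult[symmetric]) (auto simp: powr_powr mult_ac)
    also have "2 powr ((\<rho> + real i) * (s - ?d)) * 2 powr ((\<rho> + real i + 1) * (?d - ?d / q))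
      = A powr (1 - s * q / ?d) * 2 powr (?d - ?d / q) * (2 powr (s - ?d / q)) ^ i"
    proof -
      have "(\<rho> + real i) * (s - ?d) + (\<rho> + real i + 1) * (?d - ?d / q)
        = a * (1 - s * q / ?d) + (?d - ?d / q) + (s - ?d / q) * real i"
        unfolding \<rho>_def using d q by (simp add: field_simps)
      then show ?thesis
        unfolding th by (simp add: powr_realpow[symmetric] powr_powr powr_add[symmetric])
    qed
    finally show "(\<integral>\<^sup>+y. f i y \<partial>lborel)
      \<le> ennreal ((A powr (1 - s * q / ?d) * (c * 2 powr (?d - ?d / q))) * (2 powr (s - ?d / q)) ^ i)"
      by (simp add: mult_ac)
  qed
  also have "\<dots> = ennreal ((A powr (1 - s * q / ?d) * 2 powr (2 * ?d - s)) / (1 - 2 powr - s))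
    + ennreal ((A powr (1 - s * q / ?d) * (c * 2 powr (?d - ?d / q))) / (1 - 2 powr (s - ?d / q)))"
    using c lt1 by (intro arg_cong2[where f="(+)"] suminf_ennreal_geometric) auto
  also have "\<dots> = ennreal (hedberg_constant TYPE('a) q s c * A powr (1 - s * q / ?d))"
  proof -
    have "2 powr - s < (1::real)" "2 powr (s - ?d / q) < (1::real)"
      by (rule lt1)+
    then show ?thesis
      using c by (subst ennreal_plus[symmetric])
        (auto simp: hedberg_constant_def ring_distribs mult_ac)
  qed
  finally show ?thesis .
qed

text \<open>Hedberg's estimate with \<open>A\<close> equal to \<open>2 ^ d\<close> times the maximal
  function, the factor coming from non-dyadic radii.\<close>

lemma riesz_integral_le_maximal:
  fixes g :: "'a::euclidean_space \<Rightarrow> real" and q s :: real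
  defines "c \<equiv> unit_ball_vol (real DIM('a)) + 1"
  assumes gm [measurable]: "g \<in> borel_measurable borel" and g: "\<And>y. 0 \<le> g y"
    and q: "1 < q" and s: "0 < s" "s < DIM('a) / q"
    and int: "(\<integral>\<^sup>+y. ennreal (g y powr q) \<partial>lborel) \<le> 1"
    and fin: "maximal (\<lambda>y. ennreal (g y)) x < \<infinity>"
  shows "(\<integral>\<^sup>+y. ennreal (g y / norm (x - y) powr (DIM('a) - s)) \<partial>lborel)
    \<le> ennreal (hedberg_constant TYPE('a) q s c * (2 ^ DIM('a)) powr (1 - s * q / DIM('a))
        * enn2real (maximal (\<lambda>y. ennreal (g y)) x) powr (1 - s * q / DIM('a)))"
    (is "?I \<le> _")
proof -
  let ?d = "DIM('a)"
  let ?H = "hedberg_constant TYPE('a) q s c"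
  let ?e = "1 - s * q / ?d"
  define t where "t = enn2real (maximal (\<lambda>y. ennreal (g y)) x)"
  have t: "maximal (\<lambda>y. ennreal (g y)) x = ennreal t" "t \<ge> 0"
    unfolding t_def using fin by auto
  have c: "c \<ge> 0" unfolding c_def by simp
  have H: "?H > 0" by (rule hedberg_constant_pos[OF s c])
  have e: "?e > 0" using s q by (simp add: field_simps)
  have main: "?I \<le> ennreal (?H * A powr ?e)" if A: "A > 0" "2 ^ ?d * t \<le> A" for A
  proof (rule hedberg[OF gm g q s A(1) c])
    fix r :: real assume r: "0 < r"
    have "(\<integral>\<^sup>+y\<in>ball x r. ennreal (g y) \<partial>lborel) \<le> ennreal t * ennreal ((2 * r) ^ ?d)"
      using ball_integral_le_maximal[OF r, of "\<lambda>y. ennreal (g y)" x] t by simp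
    also have "\<dots> = ennreal (2 ^ ?d * t * r ^ ?d)"
      using t r by (subst ennreal_mult[symmetric]) (auto simp: power_mult_distrib mult_ac)
    also have "\<dots> \<le> ennreal (A * r ^ ?d)"
      using A r by (intro ennreal_leI mult_right_mono) auto
    finally show "(\<integral>\<^sup>+y\<in>ball x r. ennreal (g y) \<partial>lborel) \<le> ennreal (A * r ^ ?d)" .
    show "(\<integral>\<^sup>+y\<in>ball x r. ennreal (g y) \<partial>lborel) \<le> ennreal (c * r powr (?d - ?d / q))"
      unfolding c_def by (rule ball_integral_le_Lebesgue[OF gm g q int r])
  qed
  show ?thesis
  \<comment> \<open>Hedberg's estimate requires \<open>A > 0\<close>. For \<open>t = 0\<close> every
    positive \<open>A\<close> is admissible, and \<open>A\<close> is chosen so that the bound is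
    exactly \<open>\<epsilon>\<close>.\<close>
  proof (cases "t = 0")
    case True
    have "?I \<le> 0"
    proof (rule ennreal_le_epsilon)
      fix \<epsilon> :: real assume \<epsilon>: "\<epsilon> > 0"
      have "?I \<le> ennreal (?H * ((\<epsilon> / ?H) powr (1 / ?e)) powr ?e)"
        using \<epsilon> H True by (intro main) auto
      also have "?H * ((\<epsilon> / ?H) powr (1 / ?e)) powr ?e = \<epsilon>"
        using \<epsilon> H e by (simp only: powr_powr) simp
      finally show "?I \<le> 0 + ennreal \<epsilon>" by simp
    qed
    then show ?thesis by simp
  next
    case False
    then have "?I \<le> ennreal (?H * (2 ^ ?d * t) powr ?e)"
      using t by (intro main) auto
    then show ?thesis unfolding t_def[symmetric] by (simp add: powr_mult mult.assoc)
  qed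
qed

text \<open>The pointwise bound has the power \<open>1 - s * q / d\<close> of the maximal function;
  raising it to \<open>P x\<close> divided by this number restores the exponent
  \<open>P x\<close>.\<close>

theorem riesz_integral_modular:
  fixes P :: "'a::euclidean_space \<Rightarrow> real" and q s :: real
  assumes Pm [measurable]: "P \<in> borel_measurable borel"
    and m: "1 < m" and P: "\<And>x. m \<le> P x" "\<And>x. P x \<le> U" and Pinf: "1 < Pinf"
    and hold: "\<And>x y. \<bar>P x - P y\<bar> * ln (exp 1 + 1 / norm (x - y)) \<le> K"
    and decay: "\<And>x. \<bar>P x - Pinf\<bar> * ln (exp 1 + norm x) \<le> K"
    and q: "1 < q" and s: "0 < s" "s < DIM('a) / q"
  defines "I \<equiv> \<lambda>(g :: 'a \<Rightarrow> real) x. \<integral>\<^sup>+y. ennreal (g y / norm (x - y) powr (DIM('a) - s)) \<partial>lborel"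
  obtains D where "D > 0"
    "\<And>g. g \<in> borel_measurable borel \<Longrightarrow> (\<And>y. 0 \<le> g y) \<Longrightarrow> (\<integral>\<^sup>+y. ennreal (g y powr P y) \<partial>lborel) \<le> 1 \<Longrightarrow>
      (\<integral>\<^sup>+y. ennreal (g y powr q) \<partial>lborel) \<le> 1 \<Longrightarrow> AE x in lborel. I g x < \<infinity>"
    "\<And>g. g \<in> borel_measurable borel \<Longrightarrow> (\<And>y. 0 \<le> g y) \<Longrightarrow> (\<integral>\<^sup>+y. ennreal (g y powr P y) \<partial>lborel) \<le> 1 \<Longrightarrow>
      (\<integral>\<^sup>+y. ennreal (g y powr q) \<partial>lborel) \<le> 1 \<Longrightarrow>
      (\<integral>\<^sup>+x. ennreal ((enn2real (I g x) / D) powr (P x / (1 - s * q / DIM('a)))) \<partial>lborel) \<le> 1"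
proof -
  let ?M = "\<lambda>g. maximal (\<lambda>y. ennreal (g y :: real))"
  obtain C where C: "C > 0"
    and fin: "\<And>g. g \<in> borel_measurable borel \<Longrightarrow> (\<And>y. 0 \<le> g y) \<Longrightarrow> (\<integral>\<^sup>+y. ennreal (g y powr P y) \<partial>lborel) \<le> 1 \<Longrightarrow>
      AE x in lborel. ?M g x < \<infinity>"
    and bound: "\<And>g. g \<in> borel_measurable borel \<Longrightarrow> (\<And>y. 0 \<le> g y) \<Longrightarrow> (\<integral>\<^sup>+y. ennreal (g y powr P y) \<partial>lborel) \<le> 1 \<Longrightarrow>
      (\<integral>\<^sup>+x. ennreal (enn2real (?M g x) powr P x) \<partial>lborel) \<le> ennreal C"
    using maximal_variable_exponent[OF Pm m P Pinf hold decay] by blast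
  let ?e = "1 - s * q / DIM('a)"
  define H where "H = hedberg_constant TYPE('a) q s (unit_ball_vol (real DIM('a)) + 1) * (2 ^ DIM('a)) powr ?e"
  have H: "H > 0"
    unfolding H_def using hedberg_constant_pos[OF s, of "unit_ball_vol (real DIM('a)) + 1"] by simp
  have e: "?e > 0" "?e \<le> 1" using s q by (simp_all add: field_simps)
  \<comment> \<open>The final exponent is at least 1, so dividing by \<open>C + 1\<close> before
    taking the power shrinks the modular by at least that factor and brings the bound
    \<open>C\<close> below 1.\<close>
  define D where "D = H * (C + 1)"
  have D: "D > 0" unfolding D_def using H C by simp
  show thesis
  proof (rule that[OF D])
    fix g :: "'a \<Rightarrow> real"
    assume gm [measurable]: "g \<in> borel_measurable borel" and g: "\<And>y. 0 \<le> g y"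
      and mod: "(\<integral>\<^sup>+y. ennreal (g y powr P y) \<partial>lborel) \<le> 1"
      and int: "(\<integral>\<^sup>+y. ennreal (g y powr q) \<partial>lborel) \<le> 1"
    have pt: "I g x \<le> ennreal (H * enn2real (?M g x) powr ?e)" if "?M g x < \<infinity>" for x
      unfolding I_def H_def by (rule riesz_integral_le_maximal[OF gm g q s int that])
    show "AE x in lborel. I g x < \<infinity>"
      using fin[OF gm g mod]
      by eventually_elim (rule le_less_trans[OF pt], auto)
    have "(\<integral>\<^sup>+x. ennreal ((enn2real (I g x) / D) powr (P x / ?e)) \<partial>lborel)
      \<le> (\<integral>\<^sup>+x. ennreal (1 / (C + 1)) * ennreal (enn2real (?M g x) powr P x) \<partial>lborel)"
    proof (rule nn_integral_mono_AE)
      show "AE x in lborel. ennreal ((enn2real (I g x) / D) powr (P x / ?e))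
        \<le> ennreal (1 / (C + 1)) * ennreal (enn2real (?M g x) powr P x)"
        using fin[OF gm g mod]
      proof eventually_elim
        fix x assume M: "?M g x < \<infinity>"
        let ?t = "enn2real (?M g x)"
        have Pe: "P x / ?e \<ge> 1"
          using e m P(1)[of x] by simp
        have "enn2real (I g x) \<le> H * ?t powr ?e"
          using pt[OF M] H by (intro enn2real_leI) auto
        then have "enn2real (I g x) / D \<le> H * ?t powr ?e / D"
          using D by (intro divide_right_mono) auto
        also have "\<dots> = ?t powr ?e * (1 / (C + 1))"
          unfolding D_def using H by simp
        finally have "enn2real (I g x) / D \<le> ?t powr ?e * (1 / (C + 1))" .
        then have "(enn2real (I g x) / D) powr (P x / ?e) \<le> (?t powr ?e * (1 / (C + 1))) powr (P x / ?e)"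
          using Pe D by (intro powr_mono2) auto
        also have "\<dots> = (?t powr ?e) powr (P x / ?e) * (1 / (C + 1)) powr (P x / ?e)"
          by (rule powr_mult)
        also have "(?t powr ?e) powr (P x / ?e) = ?t powr P x"
          unfolding powr_powr using e by simp
        also have "?t powr P x * (1 / (C + 1)) powr (P x / ?e) \<le> ?t powr P x * (1 / (C + 1)) powr 1"
          using C Pe by (intro mult_left_mono powr_mono') auto
        finally have "(enn2real (I g x) / D) powr (P x / ?e) \<le> 1 / (C + 1) * ?t powr P x"
          using C by (simp add: mult.commute)
        then show "ennreal ((enn2real (I g x) / D) powr (P x / ?e)) \<le> ennreal (1 / (C + 1)) * ennreal (?t powr P x)"
          using C by (subst ennreal_mult[symmetric]) (auto intro!: ennreal_leI)
      qed
    qed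
    also have "\<dots> = ennreal (1 / (C + 1)) * (\<integral>\<^sup>+x. ennreal (enn2real (?M g x) powr P x) \<partial>lborel)"
      by (simp add: nn_integral_cmult)
    also have "\<dots> \<le> ennreal (1 / (C + 1)) * ennreal C"
      by (intro mult_left_mono bound gm g mod) auto
    also have "\<dots> = ennreal (1 / (C + 1) * C)"
      using C by (intro ennreal_mult[symmetric]) auto
    also have "\<dots> \<le> 1"
      using C by (subst ennreal_le_1) (simp add: field_simps)
    finally show "(\<integral>\<^sup>+x. ennreal ((enn2real (I g x) / D) powr (P x / ?e)) \<partial>lborel) \<le> 1" .
  qed
qed

section \<open>The Riesz potential\<close>

lemma continuous_le_everywhere_if_AE:
  fixes f :: "'a::euclidean_space \<Rightarrow> real"
  assumes f: "continuous_on UNIV f" and ae: "AE x in lebesgue. f x \<le> c"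
  shows "f x \<le> c"
proof -
  let ?S = "{x. c < f x}"
  have "open ?S" using f by (intro open_Collect_less continuous_intros) auto
  moreover have "negligible ?S"
  proof -
    have "?S \<in> sets lebesgue" using \<open>open ?S\<close> by auto
    then have "?S \<in> null_sets lebesgue"
      using ae by (subst AE_iff_null_sets) (auto simp: not_less)
    then show ?thesis by (simp add: negligible_iff_null_sets)
  qed
  \<comment> \<open>A nonempty open set has positive measure, so the open null set of exceptions is
    empty.\<close>
  ultimately have "?S = {}" using open_not_negligible by blast
  then show ?thesis by (auto simp: not_less[symmetric])
qed

lemma continuous_on_if_log_Hoelder:
  fixes f :: "'a::real_normed_vector \<Rightarrow> real"
  assumes "\<And>x y. \<bar>f x - f y\<bar> \<le> C / ln (exp 1 + 1 / norm (x - y))"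
  shows "continuous_on UNIV f"
proof -
  have "f \<midarrow>x\<rightarrow> f x" for x
  proof (rule LIM_zero_cancel, rule Lim_null_comparison)
    show "\<forall>\<^sub>F y in at x. norm (f y - f x) \<le> C / ln (exp 1 + 1 / norm (y - x))"
      using assms by simp
    have "filterlim (\<lambda>t::real. exp 1 + inverse t) at_top (at_right 0)"
      by (intro filterlim_tendsto_add_at_top[OF tendsto_const] filterlim_inverse_at_top_right)
    then have "filterlim (\<lambda>t::real. ln (exp 1 + inverse t)) at_top (at_right 0)"
      by (rule filterlim_compose[OF ln_at_top])
    then have lim: "((\<lambda>t::real. C / ln (exp 1 + inverse t)) \<longlongrightarrow> 0) (at_right 0)"
      by (intro tendsto_divide_0[OF tendsto_const] filterlim_at_top_imp_at_infinity)
    have "((\<lambda>y. norm (y - x)) \<longlongrightarrow> norm (x - x)) (at x)"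
      by (intro tendsto_intros)
    then have "filterlim (\<lambda>y. norm (y - x)) (at_right 0) (at x)"
      unfolding filterlim_at by (auto simp: eventually_at_filter)
    from filterlim_compose[OF lim this]
    show "((\<lambda>y. C / ln (exp 1 + 1 / norm (y - x))) \<longlongrightarrow> 0) (at x)"
      by (simp add: inverse_eq_divide)
  qed
  then show ?thesis by (simp add: continuous_on_def)
qed

text \<open>Since \<open>a - b\<close> is, up to sign, \<open>(1 / a - 1 / b) * (a * b)\<close>, the
  passage from reciprocals to exponents costs \<open>U\<^sup>2\<close>. The hypothesis
  \<open>exp 1 \<le> t\<close> makes the logarithm positive; it also holds for \<open>x = y\<close>,
  where \<open>1 / 0 = 0\<close>.\<close>

lemma reciprocal_bound_mult:
  fixes a b C U t :: real
  assumes "\<bar>1 / a - 1 / b\<bar> \<le> C / ln t" "0 < a" "a \<le> U" "0 < b" "b \<le> U" "exp 1 \<le> t"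
  shows "\<bar>a - b\<bar> * ln t \<le> U\<^sup>2 * C"
proof -
  have "ln (exp 1) \<le> ln t"
    using assms less_le_trans[OF exp_gt_zero] by (subst ln_le_cancel_iff) auto
  then have t: "ln t \<ge> 1" by simp
  have "\<bar>a - b\<bar> = \<bar>1 / a - 1 / b\<bar> * (a * b)"
  proof -
    have "a - b = - ((1 / a - 1 / b) * (a * b))"
      using assms by (simp add: field_simps)
    then have "\<bar>a - b\<bar> = \<bar>(1 / a - 1 / b) * (a * b)\<bar>" by linarith
    then show ?thesis using assms by (simp add: abs_mult)
  qed
  also have "\<dots> \<le> \<bar>1 / a - 1 / b\<bar> * U\<^sup>2"
    using assms unfolding power2_eq_square by (intro mult_left_mono mult_mono) auto
  finally have "\<bar>a - b\<bar> * ln t \<le> \<bar>1 / a - 1 / b\<bar> * U\<^sup>2 * ln t"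
    using t by (intro mult_right_mono) auto
  also have "\<dots> = U\<^sup>2 * (\<bar>1 / a - 1 / b\<bar> * ln t)" by simp
  also have "\<dots> \<le> U\<^sup>2 * C"
    using assms t by (intro mult_left_mono) (auto simp: field_simps)
  finally show ?thesis .
qed

text \<open>The essential bounds control \<open>p\<close> only almost everywhere, but the reciprocal
  is continuous by the log-Hoelder condition, so they hold at every point. This also excludes
  infinite values of \<open>p\<close>.\<close>

lemma log_Hoelder_exponent_real:
  fixes p :: "real ^ 'n \<Rightarrow> ereal"
  assumes p: "p \<in> log_Hoelder_exponents"
    and lower: "1 < exponent_lower p" and upper: "exponent_upper p < \<infinity>"
  obtains P :: "real ^ 'n \<Rightarrow> real" and m U Pinf K :: real
  where "p = (\<lambda>x. ereal (P x))" "P \<in> borel_measurable borel" "1 < m" "\<And>x. m \<le> P x" "\<And>x. P x \<le> U"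
    "1 < Pinf" "\<And>x y. \<bar>P x - P y\<bar> * ln (exp 1 + 1 / norm (x - y)) \<le> K"
    "\<And>x. \<bar>P x - Pinf\<bar> * ln (exp 1 + norm x) \<le> K"
proof -
  obtain C L where hold: "\<And>x y. \<bar>recip p x - recip p y\<bar> \<le> C / ln (exp 1 + 1 / norm (x - y))"
    and lim: "(recip p \<longlongrightarrow> L) at_infinity"
    and decay: "\<And>x. \<bar>recip p x - L\<bar> \<le> C / ln (exp 1 + norm x)"
    and p1: "\<And>x. 1 \<le> p x"
    using p unfolding log_Hoelder_exponents_def variable_exponents_def by blast
  obtain m where m: "1 < ereal m" "ereal m < exponent_lower p"
    using ereal_dense2[OF lower] by blast
  then have m1: "1 < m" by simp
  obtain V where V: "exponent_upper p < ereal V"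
    using ereal_dense2[OF upper] by blast
  \<comment> \<open>The maximum ensures that \<open>U\<close> is positive, so that
    \<open>1 / U\<close> is a positive lower bound for the reciprocal.\<close>
  define U where "U = max V m"
  have U: "U \<ge> m" unfolding U_def by simp
  have ae: "AE x in lebesgue. 1 / U \<le> recip p x \<and> recip p x \<le> 1 / m"
  proof -
    have "AE x in lebesgue. ereal m < p x"
      using m(2) unfolding exponent_lower_def essinf_def by (rule less_LiminfD)
    moreover have "AE x in lebesgue. p x \<le> exponent_upper p"
      unfolding exponent_upper_def by (rule esssup_AE)
    ultimately show ?thesis
    proof eventually_elim
      fix x assume 1: "ereal m < p x" and 2: "p x \<le> exponent_upper p"
      have "p x < ereal V" using 2 V by (rule le_less_trans)
      with 1 obtain r where r: "p x = ereal r" "m < r" "r < V"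
        by (cases "p x") auto
      then have "recip p x = 1 / r" using m1 by (simp add: recip_def one_ereal_def)
      then show "1 / U \<le> recip p x \<and> recip p x \<le> 1 / m"
        using r m1 unfolding U_def by (auto intro!: divide_left_mono mult_pos_pos)
    qed
  qed
  have cont: "continuous_on UNIV (recip p)"
    by (rule continuous_on_if_log_Hoelder[OF hold])
  have le: "recip p x \<le> 1 / m" for x
    using ae by (intro continuous_le_everywhere_if_AE cont) auto
  have ge: "1 / U \<le> recip p x" for x
  proof -
    have "- recip p x \<le> - (1 / U)"
      using ae by (intro continuous_le_everywhere_if_AE[of "\<lambda>x. - recip p x"] continuous_intros cont) auto
    then show ?thesis by simp
  qed
  have pos: "recip p x > 0" for x
    using ge[of x] U m1 less_le_trans[of 0 "1 / U" "recip p x"] by auto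
  define P where "P x = 1 / recip p x" for x
  have eqP: "p x = ereal (P x)" for x
    using pos[of x] p1[of x] unfolding P_def recip_def by (cases "p x") (auto simp: one_ereal_def)
  have PmU: "m \<le> P x" "P x \<le> U" for x
    using le[of x] ge[of x] pos[of x] U m1 unfolding P_def by (auto simp: field_simps)
  \<comment> \<open>The bounds pass to the limit at infinity, which places
    \<open>Pinf = 1 / L\<close> between \<open>m\<close> and \<open>U\<close>, hence above
    1.\<close>
  have L: "1 / U \<le> L" "L \<le> 1 / m"
    using tendsto_lowerbound[OF lim, of "1 / U"] tendsto_upperbound[OF lim, of "1 / m"] le ge
    by (auto simp: trivial_limit_at_infinity)
  have Lpos: "L > 0" using L(1) U m1 less_le_trans[of 0 "1 / U" L] by auto
  have Linv: "1 / (1 / L) = L" "m \<le> 1 / L" "1 / L \<le> U"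
    using L Lpos U m1 by (auto simp: field_simps)
  have Pinv: "1 / P x = recip p x" for x unfolding P_def by simp
  show thesis
  proof (rule that[of P m U "1 / L" "U\<^sup>2 * C"])
    show "p = (\<lambda>x. ereal (P x))" using eqP by auto
    have "continuous_on UNIV P"
      unfolding P_def[abs_def] using pos by (intro continuous_intros cont) (metis less_irrefl)
    then show "P \<in> borel_measurable borel" by (rule borel_measurable_continuous_onI)
    show "1 < m" "\<And>x. m \<le> P x" "\<And>x. P x \<le> U" by fact+
    show "1 < 1 / L" using Linv m1 by linarith
    have P0: "P x > 0" for x using PmU(1)[of x] m1 by linarith
    show "\<bar>P x - P y\<bar> * ln (exp 1 + 1 / norm (x - y)) \<le> U\<^sup>2 * C" for x y
      using hold[of x y] PmU P0 by (intro reciprocal_bound_mult) (auto simp: Pinv)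
    show "\<bar>P x - 1 / L\<bar> * ln (exp 1 + norm x) \<le> U\<^sup>2 * C" for x
      using decay[of x] PmU P0 Linv Lpos by (intro reciprocal_bound_mult) (auto simp: Pinv)
  qed
qed

section \<open>Borel representatives and consequences of a small norm\<close>

lemma completion_ex_borel_measurable_euclidean:
  fixes f :: "'a \<Rightarrow> 'b::euclidean_space"
  assumes f: "f \<in> borel_measurable (completion M)"
  obtains F where "F \<in> borel_measurable M" "AE x in M. f x = F x"
proof -
  have "\<exists>F\<in>borel_measurable M. AE x in M. f x \<bullet> b = F x" for b
    using f by (intro completion_ex_borel_measurable_real) auto
  then obtain F where F: "\<And>b. F b \<in> borel_measurable M" "\<And>b. AE x in M. f x \<bullet> b = F b x"
    by metis
  show thesis
  proof
    show "(\<lambda>x. \<Sum>b\<in>Basis. F b x *\<^sub>R b) \<in> borel_measurable M"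
      using F(1) by measurable
    have "AE x in M. \<forall>b\<in>Basis. f x \<bullet> b = F b x"
      using F(2) by (subst AE_ball_countable) (auto simp: countable_finite)
    then show "AE x in M. f x = (\<Sum>b\<in>Basis. F b x *\<^sub>R b)"
    proof eventually_elim
      fix x assume *: "\<forall>b\<in>Basis. f x \<bullet> b = F b x"
      have "f x = (\<Sum>b\<in>Basis. (f x \<bullet> b) *\<^sub>R b)" by (simp add: euclidean_representation)
      also have "\<dots> = (\<Sum>b\<in>Basis. F b x *\<^sub>R b)" using * by (intro sum.cong) auto
      finally show "f x = (\<Sum>b\<in>Basis. F b x *\<^sub>R b)" .
    qed
  qed
qed

text \<open>A strict inequality provides an admissible divisor \<open>l' < l\<close>, so it does not
  matter whether the infimum is attained; the modular decreases as the divisor grows.\<close>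

lemma modular_le_1_if_luxemburg_norm_less:
  fixes f :: "real ^ 'n \<Rightarrow> 'b::{real_normed_field, euclidean_space}"
  assumes less: "luxemburg_norm p f < ennreal l" and l: "0 < l" and p: "\<And>x. 0 \<le> real_of_ereal (p x)"
  shows "modular p (\<lambda>x. f x /\<^sub>R l) \<le> 1"
proof -
  obtain l' where l': "0 < l'" "modular p (\<lambda>x. f x /\<^sub>R l') \<le> 1" "l' < l"
    using less unfolding luxemburg_norm_def Inf_less_iff by (auto simp: ennreal_less_iff)
  have "modular p (\<lambda>x. f x /\<^sub>R l) \<le> modular p (\<lambda>x. f x /\<^sub>R l')"
    unfolding modular_def
  proof (intro nn_integral_mono ennreal_leI powr_mono2 p)
    fix x
    have "inverse l * norm (f x) \<le> inverse l' * norm (f x)"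
      using l' l by (intro mult_right_mono) auto
    then show "norm (f x /\<^sub>R l) \<le> norm (f x /\<^sub>R l')" using l' l by simp
  qed simp
  then show ?thesis using l' by simp
qed

lemma integral_le_1_if_Lebesgue_norm_less:
  fixes f :: "real ^ 'n \<Rightarrow> 'b::{real_normed_field, euclidean_space}"
  assumes fm [measurable]: "f \<in> borel_measurable lebesgue"
    and less: "Lebesgue_norm q f < ennreal l" and l: "0 < l" and q: "0 < q"
  shows "(\<integral>\<^sup>+x. ennreal ((norm (f x) / l) powr q) \<partial>lebesgue) \<le> 1"
proof -
  define I where "I = (\<integral>\<^sup>+x. ennreal (norm (f x) powr q) \<partial>lebesgue)"
  have I: "I \<noteq> \<infinity>" "ennreal (enn2real I powr (1 / q)) < ennreal l"
    using less unfolding Lebesgue_norm_def I_def[symmetric] Let_def by (auto split: if_splits)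
  then have "enn2real I powr (1 / q) \<le> l"
    using l by (simp add: ennreal_less_iff)
  then have "(enn2real I powr (1 / q)) powr q \<le> l powr q"
    using q by (intro powr_mono2) auto
  then have "enn2real I \<le> l powr q" using q by (simp add: powr_powr)
  then have Il: "I \<le> ennreal (l powr q)"
    using I(1) by (cases I) (auto simp: ennreal_leI)
  have "(\<integral>\<^sup>+x. ennreal ((norm (f x) / l) powr q) \<partial>lebesgue)
    = (\<integral>\<^sup>+x. ennreal (1 / l powr q) * ennreal (norm (f x) powr q) \<partial>lebesgue)"
    using l by (intro nn_integral_cong) (simp add: ennreal_mult[symmetric] powr_divide)
  also have "\<dots> = ennreal (1 / l powr q) * I"
    unfolding I_def by (intro nn_integral_cmult) measurable
  also have "\<dots> \<le> ennreal (1 / l powr q) * ennreal (l powr q)"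
    by (intro mult_left_mono Il) auto
  also have "\<dots> = 1" using l by (simp add: ennreal_mult[symmetric])
  finally show ?thesis .
qed

lemma riesz_constant_pos: "0 < s \<Longrightarrow> s < real n \<Longrightarrow> riesz_constant n s > 0"
  unfolding riesz_constant_def by (intro divide_pos_pos mult_pos_pos Gamma_real_pos) auto

text \<open>The exceptional null set does not depend on \<open>x\<close>, so the potentials of
  \<open>f\<close> and of its Borel representative agree at every \<open>x\<close>. For
  \<open>F\<close> the integrand is jointly Borel in \<open>x\<close> and \<open>y\<close>, which
  yields measurability of the potential.\<close>

lemma riesz_integrand_completion:
  fixes f F :: "real ^ 'n \<Rightarrow> 'b::{real_normed_field, euclidean_space}"
  assumes fm [measurable]: "f \<in> borel_measurable lebesgue"
    and Fm [measurable]: "F \<in> borel_measurable borel"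
    and ae: "AE y in lborel. f y = F y"
  shows "integrable lebesgue (riesz_integrand s f x) \<longleftrightarrow> integrable lborel (riesz_integrand s F x)"
    and "(\<integral>y. riesz_integrand s f x y \<partial>lebesgue) = (\<integral>y. riesz_integrand s F x y \<partial>lborel)"
proof -
  have km: "(\<lambda>y. norm (x - y) powr (real CARD('n) - s)) \<in> borel_measurable borel"
    by measurable
  then have kml [measurable]: "(\<lambda>y. norm (x - y) powr (real CARD('n) - s)) \<in> borel_measurable lebesgue"
    by (intro measurable_completion) simp
  have fml: "riesz_integrand s f x \<in> borel_measurable lebesgue"
    unfolding riesz_integrand_def[abs_def] by measurable
  have Fmb: "riesz_integrand s F x \<in> borel_measurable lborel"
    unfolding riesz_integrand_def[abs_def] by measurable
  then have Fml: "riesz_integrand s F x \<in> borel_measurable lebesgue"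
    by (rule measurable_completion)
  have ae': "AE y in lebesgue. riesz_integrand s f x y = riesz_integrand s F x y"
    using AE_completion[OF ae] by eventually_elim (simp add: riesz_integrand_def)
  show "integrable lebesgue (riesz_integrand s f x) \<longleftrightarrow> integrable lborel (riesz_integrand s F x)"
    using integrable_cong_AE[OF fml Fml ae'] integrable_completion[OF Fmb] by simp
  show "(\<integral>y. riesz_integrand s f x y \<partial>lebesgue) = (\<integral>y. riesz_integrand s F x y \<partial>lborel)"
    using integral_cong_AE[OF fml Fml ae'] integral_completion[OF Fmb] by simp
qed


text \<open>Almost everywhere integrability is part of the conclusion because the Bochner integral
  is 0 by convention where the integrand is not integrable; the norm bound alone would not show that
  the potential converges.\<close>

theorem theorem4:
  fixes p \<sigma> :: "real ^ 'n \<Rightarrow> ereal" and q s \<theta> :: real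
  assumes "1 < q"
    and "p \<in> log_Hoelder_exponents"
    and "1 < exponent_lower p" and "exponent_lower p \<le> exponent_upper p"
    and "exponent_upper p < \<infinity>"
    and "0 < s"
    and "ereal s < min (ereal (real CARD('n)) / exponent_upper p) (ereal (real CARD('n) / q))"
    and "\<theta> = s * q / real CARD('n)"
    and "\<sigma> = (\<lambda>x. p x / ereal (1 - \<theta>))"
  shows "\<exists>C::real. C > 0 \<and>
    (\<forall>f :: real ^ 'n \<Rightarrow> 'b::{real_normed_field, euclidean_space}. f \<in> mixed_Lebesgue p q \<longrightarrow>
      (AE x in lebesgue. integrable lebesgue (riesz_integrand s f x)) \<and>
      riesz_potential s f \<in> variable_Lebesgue \<sigma> \<and>
      luxemburg_norm \<sigma> (riesz_potential s f) \<le> ennreal C * mixed_norm p q f)"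
proof -
  let ?d = "real CARD('n)"
  obtain P :: "real ^ 'n \<Rightarrow> real" and m U Pinf K :: real
    where pP: "p = (\<lambda>x. ereal (P x))" and Pm [measurable]: "P \<in> borel_measurable borel"
      and m: "1 < m" and P: "\<And>x. m \<le> P x" "\<And>x. P x \<le> U" and Pinf: "1 < Pinf"
      and hold: "\<And>x y. \<bar>P x - P y\<bar> * ln (exp 1 + 1 / norm (x - y)) \<le> K"
      and decay: "\<And>x. \<bar>P x - Pinf\<bar> * ln (exp 1 + norm x) \<le> K"
    using log_Hoelder_exponent_real[OF assms(2,3,5)] by blast
  have q: "1 < q" and s: "0 < s" by fact+
  have sq: "s < ?d / q" using assms(7) by simp
  have sq': "s < DIM(real ^ 'n) / q" using sq by simp
  have sd: "s < ?d"
  proof -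
    have "?d / q \<le> ?d / 1" using q by (intro divide_left_mono) auto
    then show ?thesis using sq by simp
  qed
  have \<theta>: "\<theta> < 1" unfolding assms(8) using sq q by (simp add: field_simps)
  have \<sigma>: "real_of_ereal (\<sigma> x) = P x / (1 - \<theta>)" for x
    unfolding assms(9) pP using \<theta> by simp
  define I where "I g x = (\<integral>\<^sup>+y. ennreal (g y / norm (x - y) powr (?d - s)) \<partial>lborel)"
    for g :: "real ^ 'n \<Rightarrow> real" and x
  obtain D where D: "D > 0"
    and Ifin: "\<And>g. g \<in> borel_measurable borel \<Longrightarrow> (\<And>y. 0 \<le> g y) \<Longrightarrow> (\<integral>\<^sup>+y. ennreal (g y powr P y) \<partial>lborel) \<le> 1 \<Longrightarrow>
      (\<integral>\<^sup>+y. ennreal (g y powr q) \<partial>lborel) \<le> 1 \<Longrightarrow> AE x in lborel. I g x < \<infinity>"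
    and Imod: "\<And>g. g \<in> borel_measurable borel \<Longrightarrow> (\<And>y. 0 \<le> g y) \<Longrightarrow> (\<integral>\<^sup>+y. ennreal (g y powr P y) \<partial>lborel) \<le> 1 \<Longrightarrow>
      (\<integral>\<^sup>+y. ennreal (g y powr q) \<partial>lborel) \<le> 1 \<Longrightarrow>
      (\<integral>\<^sup>+x. ennreal ((enn2real (I g x) / D) powr (P x / (1 - \<theta>))) \<partial>lborel) \<le> 1"
    using riesz_integral_modular[OF Pm m P Pinf hold decay q s sq']
    unfolding I_def assms(8) by auto
  define c where "c = riesz_constant CARD('n) s"
  have c: "c > 0" unfolding c_def by (rule riesz_constant_pos[OF s sd])
  \<comment> \<open>Homogeneity: dividing by any \<open>l\<close> above the mixed norm makes the
    modular and the \<open>L^q\<close> integral at most 1, and the kernel estimate scales back by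
    \<open>l\<close>.\<close>
  have main: "(AE x in lebesgue. integrable lebesgue (riesz_integrand s f x)) \<and>
      riesz_potential s f \<in> borel_measurable lebesgue \<and>
      luxemburg_norm \<sigma> (riesz_potential s f) \<le> ennreal (c * D * l)"
    if fm [measurable]: "f \<in> borel_measurable lebesgue" and l: "0 < l" and fl: "mixed_norm p q f < ennreal l"
    for f :: "real ^ 'n \<Rightarrow> 'b" and l
  proof -
    obtain F where Fb: "F \<in> borel_measurable lborel" and ae: "AE y in lborel. f y = F y"
      using completion_ex_borel_measurable_euclidean[OF fm] .
    then have Fm [measurable]: "F \<in> borel_measurable borel" by simp
    define g where "g y = norm (F y) / l" for y
    have gm [measurable]: "g \<in> borel_measurable borel" unfolding g_def[abs_def] by measurable
    have g0: "g y \<ge> 0" for y unfolding g_def using l by simp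
    have lux: "luxemburg_norm p f < ennreal l" and leb: "Lebesgue_norm q f < ennreal l"
      using fl unfolding mixed_norm_def by auto
    have P0: "P x > 0" for x using P(1)[of x] m by linarith
    have mod: "(\<integral>\<^sup>+y. ennreal (g y powr P y) \<partial>lborel) \<le> 1"
    proof -
      have "(\<integral>\<^sup>+y. ennreal (g y powr P y) \<partial>lborel) = (\<integral>\<^sup>+y. ennreal (norm (f y /\<^sub>R l) powr P y) \<partial>lborel)"
        using ae by (intro nn_integral_cong_AE, eventually_elim) (use l in \<open>simp add: g_def divide_inverse_commute\<close>)
      also have "\<dots> = modular p (\<lambda>y. f y /\<^sub>R l)"
        by (simp add: modular_def nn_integral_completion pP)
      also have "\<dots> \<le> 1"
        using P0 by (intro modular_le_1_if_luxemburg_norm_less[OF lux l]) (simp add: pP less_imp_le)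
      finally show ?thesis .
    qed
    have int: "(\<integral>\<^sup>+y. ennreal (g y powr q) \<partial>lborel) \<le> 1"
    proof -
      have "(\<integral>\<^sup>+y. ennreal (g y powr q) \<partial>lborel) = (\<integral>\<^sup>+y. ennreal ((norm (f y) / l) powr q) \<partial>lborel)"
        using ae by (intro nn_integral_cong_AE, eventually_elim) (simp add: g_def)
      also have "\<dots> = (\<integral>\<^sup>+y. ennreal ((norm (f y) / l) powr q) \<partial>lebesgue)"
        by (simp add: nn_integral_completion)
      also have "\<dots> \<le> 1"
        using q by (intro integral_le_1_if_Lebesgue_norm_less[OF fm leb l]) simp
      finally show ?thesis .
    qed
    have Fmx: "riesz_integrand s F x \<in> borel_measurable lborel" for x
      unfolding riesz_integrand_def[abs_def] by measurable
    have nI: "(\<integral>\<^sup>+y. ennreal (norm (riesz_integrand s F x y)) \<partial>lborel) = ennreal l * I g x" for x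
    proof -
      have "(\<integral>\<^sup>+y. ennreal (norm (riesz_integrand s F x y)) \<partial>lborel)
        = (\<integral>\<^sup>+y. ennreal l * ennreal (g y / norm (x - y) powr (?d - s)) \<partial>lborel)"
        using l g0 by (intro nn_integral_cong)
          (simp add: riesz_integrand_def g_def ennreal_mult[symmetric] divide_inverse mult_ac)
      also have "\<dots> = ennreal l * I g x"
        unfolding I_def by (intro nn_integral_cmult) measurable
      finally show ?thesis .
    qed
    have Fint: "integrable lborel (riesz_integrand s F x)" if "I g x < \<infinity>" for x
      using that by (intro integrableI_bounded Fmx) (simp add: nI ennreal_mult_less_top)
    have fin: "AE x in lborel. I g x < \<infinity>"
      by (rule Ifin[OF gm g0 mod int])
    have "AE x in lebesgue. integrable lebesgue (riesz_integrand s f x)"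
      using AE_completion[OF fin]
      by eventually_elim (simp add: riesz_integrand_completion(1)[OF fm Fm ae] Fint)
    moreover have pot: "riesz_potential s f x = c *\<^sub>R (\<integral>y. riesz_integrand s F x y \<partial>lborel)" for x
      unfolding riesz_potential_def c_def riesz_integrand_completion(2)[OF fm Fm ae] ..
    have "(\<lambda>x. c *\<^sub>R (\<integral>y. riesz_integrand s F x y \<partial>lborel)) \<in> borel_measurable lborel"
      unfolding riesz_integrand_def[abs_def] by measurable
    then have "riesz_potential s f \<in> borel_measurable lborel"
      unfolding pot[abs_def, symmetric] by (simp add: pot[symmetric])
    then have "riesz_potential s f \<in> borel_measurable lebesgue"
      by (rule measurable_completion)
    moreover have "luxemburg_norm \<sigma> (riesz_potential s f) \<le> ennreal (c * D * l)"
      unfolding luxemburg_norm_def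
    proof (rule Inf_lower, intro CollectI exI conjI)
      show "0 < c * D * l" using c D l by simp
      have "modular \<sigma> (\<lambda>x. riesz_potential s f x /\<^sub>R (c * D * l))
        = (\<integral>\<^sup>+x. ennreal (norm (riesz_potential s f x /\<^sub>R (c * D * l)) powr (P x / (1 - \<theta>))) \<partial>lborel)"
        by (simp add: modular_def nn_integral_completion \<sigma>)
      also have "\<dots> \<le> (\<integral>\<^sup>+x. ennreal ((enn2real (I g x) / D) powr (P x / (1 - \<theta>))) \<partial>lborel)"
      proof (rule nn_integral_mono_AE)
        show "AE x in lborel. ennreal (norm (riesz_potential s f x /\<^sub>R (c * D * l)) powr (P x / (1 - \<theta>)))
          \<le> ennreal ((enn2real (I g x) / D) powr (P x / (1 - \<theta>)))"
          using fin
        proof eventually_elim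
          fix x assume Ix: "I g x < \<infinity>"
          have "ennreal (norm (\<integral>y. riesz_integrand s F x y \<partial>lborel)) \<le> ennreal l * I g x"
            unfolding nI[symmetric] by (intro integral_norm_bound_ennreal Fint Ix)
          also have "\<dots> = ennreal (l * enn2real (I g x))"
            using Ix l by (simp add: ennreal_mult)
          finally have "norm (\<integral>y. riesz_integrand s F x y \<partial>lborel) \<le> l * enn2real (I g x)"
            using l by (subst (asm) ennreal_le_iff) auto
          then have "norm (riesz_potential s f x) \<le> c * (l * enn2real (I g x))"
            using c unfolding pot by simp
          then have "norm (riesz_potential s f x) / (c * D * l) \<le> c * (l * enn2real (I g x)) / (c * D * l)"
            using c D l by (intro divide_right_mono) auto
          also have "\<dots> = enn2real (I g x) / D"
            using c l by simp
          finally have "norm (riesz_potential s f x /\<^sub>R (c * D * l)) \<le> enn2real (I g x) / D"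
            using c D l by (simp add: divide_inverse_commute)
          then show "ennreal (norm (riesz_potential s f x /\<^sub>R (c * D * l)) powr (P x / (1 - \<theta>)))
            \<le> ennreal ((enn2real (I g x) / D) powr (P x / (1 - \<theta>)))"
            using \<theta> P0[of x] by (intro ennreal_leI powr_mono2) auto
        qed
      qed
      also have "\<dots> \<le> 1" by (rule Imod[OF gm g0 mod int])
      finally show "modular \<sigma> (\<lambda>x. riesz_potential s f x /\<^sub>R (c * D * l)) \<le> 1" .
    qed simp
    ultimately show ?thesis by blast
  qed
  show ?thesis
  proof (intro exI[of _ "c * D"] conjI allI impI)
    show "c * D > 0" using c D by simp
    fix f :: "real ^ 'n \<Rightarrow> 'b"
    assume f: "f \<in> mixed_Lebesgue p q"
    then have fm: "f \<in> borel_measurable lebesgue" and "mixed_norm p q f < \<infinity>"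
      unfolding mixed_Lebesgue_def variable_Lebesgue_def Lebesgue_space_def mixed_norm_def by auto
    then obtain M where M: "mixed_norm p q f = ennreal M" "M \<ge> 0"
      by (cases "mixed_norm p q f") auto
    have less: "mixed_norm p q f < ennreal (M + e)" if "e > 0" for e
      using that M by (simp add: ennreal_less_iff)
    have M1: "0 < M + 1" using M by simp
    note one = main[OF fm M1 less[OF zero_less_one]]
    show "AE x in lebesgue. integrable lebesgue (riesz_integrand s f x)" using one by blast
    \<comment> \<open>Only values of \<open>l\<close> strictly above the norm \<open>M\<close> are
      admissible, also when \<open>M = 0\<close>. The choice \<open>M + e / (c * D)\<close> makes
      the excess in the bound exactly \<open>e\<close>.\<close>
    have le: "luxemburg_norm \<sigma> (riesz_potential s f) \<le> ennreal (c * D) * mixed_norm p q f"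
    proof (rule ennreal_le_epsilon)
      fix e :: real assume e: "0 < e"
      then have e': "0 < e / (c * D)" using c D by simp
      then have "0 < M + e / (c * D)" using M by linarith
      from main[OF fm this less[OF e']]
      have "luxemburg_norm \<sigma> (riesz_potential s f) \<le> ennreal (c * D * (M + e / (c * D)))" by blast
      also have "c * D * (M + e / (c * D)) = c * D * M + e" using c D by (simp add: field_simps)
      also have "ennreal \<dots> = ennreal (c * D) * mixed_norm p q f + ennreal e"
        using c D M e by (simp add: ennreal_mult)
      finally show "luxemburg_norm \<sigma> (riesz_potential s f) \<le> ennreal (c * D) * mixed_norm p q f + ennreal e" .
    qed
    then show "luxemburg_norm \<sigma> (riesz_potential s f) \<le> ennreal (c * D) * mixed_norm p q f" .
    have "ennreal (c * D) * mixed_norm p q f < \<infinity>" unfolding M by (simp add: ennreal_mult_less_top)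
    with le show "riesz_potential s f \<in> variable_Lebesgue \<sigma>"
      using one unfolding variable_Lebesgue_def by (auto intro: le_less_trans)
  qed
qed

end
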